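(* Let $Y$ be a (metrizable) manifold weakly stratified space, let $X\subset Y$ be a pure subset, and let $N$ be a neighborhood of $X$ in $Y$. Given a nearly stratum-preserving deformation retraction $R:N\times I\to N$ of $N$ to $X$, there exists a stratum-preserving homotopy equivalence between $N$ and the mapping cylinder $I_\pi$ of the holink evaluation $\pi:\mathrm{holink}_s(N,X)\to X$.
   Context: Filtered spaces. A filtered space is a space $Y$ with closed subspaces $\emptyset=Y_{-1}\subset Y_0\subset\cdots\subset Y_n=Y$; its strata are $Y_i-Y_{i-1}$. Subspaces are filtered by intersection, and $Y\times I$ by $\{Y_i\times I\}$, $I=[0,1]$. Stratum-preserving maps and homotopies are those taking the stratum of each index into the stratum of the same index. A stratum-preserving homotopy equivalence is a stratum-preserving map with a stratum-preserving map in the other direction such that both composites are stratum-preserving homotopic to the identities. Manifold weakly stratified spaces. For a pair $(A,B)$, $\mathrm{holink}(A,B)$ is the space (compact-open topology) of paths $w:I\to A$ with $w(0)\in B$ and $w((0,1])\subset A-B$. $B\subset A$ is tame if $B$ has a neighborhood $U$ in $A$ and a map $U\times I\to A$ which is the projection on $B\times I$, the inclusion on $U\times\{1\}$, maps $U\times\{0\}$ into $B$, and maps $(U-B)\times(0,1]$ into $A-B$. A filtered space $Y$ is weakly stratified if for each $k>i$, $(Y_{i+1}-Y_i)\subset(Y_{k+1}-Y_k)\cup(Y_{i+1}-Y_i)$ is tame and evaluation at $0$, $\mathrm{holink}((Y_{k+1}-Y_k)\cup(Y_{i+1}-Y_i),Y_{i+1}-Y_i)\to Y_{i+1}-Y_i$,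 is a fibration. It is manifold weakly stratified if in addition each stratum is a manifold (without boundary). Pure subset: a closed subspace $X\subset Y$ that is a union of connected strata (i.e. of connected components of the strata $Y_k-Y_{k-1}$). Nearly stratum-preserving deformation retraction of $N$ to $X$: a map $R:N\times I\to N$ with $R(y,1)=y$ for all $y\in N$, $R(x,t)=x$ for $x\in X$, $R(N\times\{0\})\subset X$, and such that for each $y\in N$ all points $R(y,t)$ with $t\in(0,1]$ lie in the stratum containing $y$, with $R(y,t)\notin X$ for $y\notin X$ and $t>0$. Stratified homotopy link: $\mathrm{holink}_s(N,X)$ is the subspace of $\mathrm{holink}(N,X)$ of paths $w$ such that $w((0,1])$ lies in a single stratum; it is filtered by $\mathrm{holink}_s(N,X)_j=\{w:w((0,1])\subset Y_j\}$. $\pi(w)=w(0)$. Mapping cylinder: as a set $I_\pi=X\sqcup(\mathrm{holink}_s(N,X)\times(0,1])$, with the teardrop topology, whose basis consists of the open subsets of $\mathrm{holink}_s(N,X)\times(0,1]$ and the sets $[\pi^{-1}(U)\times(0,\epsilon)]\cup U$ with $U\subset X$ open. It is filtered by $(I_\pi)_j=(X\cap Y_j)\cup(\mathrm{holink}_s(N,X)_j\times(0,1])$. *)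

theory Defs
  imports "HOL-Analysis.Analysis"
begin

abbreviation unit_interval :: "real topology" where
  "unit_interval \<equiv> top_of_set {0..1}"

section \<open>Filtered spaces\<close>

text \<open>A filtration \<open>F\<close> is read at the indices \<open>0, \<dots>, n\<close> only; \<open>F\<^sub>-\<^sub>1\<close> is empty.\<close>

definition filtered_space :: "'a topology \<Rightarrow> nat \<Rightarrow> (nat \<Rightarrow> 'a set) \<Rightarrow> bool" where
  "filtered_space Y n F \<longleftrightarrow>
     (\<forall>i\<le>n. closedin Y (F i)) \<and> (\<forall>i<n. F i \<subseteq> F (Suc i)) \<and> F n = topspace Y"

definition stratum :: "(nat \<Rightarrow> 'a set) \<Rightarrow> nat \<Rightarrow> 'a set" where
  "stratum F i = F i - (if i = 0 then {} else F (i - 1))"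

definition preserves_strata ::
    "nat \<Rightarrow> (nat \<Rightarrow> 'a set) \<Rightarrow> (nat \<Rightarrow> 'b set) \<Rightarrow> ('a \<Rightarrow> 'b) \<Rightarrow> bool" where
  "preserves_strata n F G f \<longleftrightarrow> (\<forall>i\<le>n. f ` stratum F i \<subseteq> stratum G i)"

definition stratum_preserving_map ::
    "nat \<Rightarrow> 'a topology \<Rightarrow> (nat \<Rightarrow> 'a set) \<Rightarrow> 'b topology \<Rightarrow> (nat \<Rightarrow> 'b set) \<Rightarrow> ('a \<Rightarrow> 'b) \<Rightarrow> bool" where
  "stratum_preserving_map n X F Y G f \<longleftrightarrow> continuous_map X Y f \<and> preserves_strata n F G f"

text \<open>A homotopy carries the strata of \<open>X \<times> I\<close>, which are the products of the strata of
  \<open>X\<close> with \<open>I\<close>, into those of \<open>Y\<close> iff each of its stages preserves strata.\<close>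

definition stratum_preserving_homotopic ::
    "nat \<Rightarrow> 'a topology \<Rightarrow> (nat \<Rightarrow> 'a set) \<Rightarrow> 'b topology \<Rightarrow> (nat \<Rightarrow> 'b set) \<Rightarrow>
      ('a \<Rightarrow> 'b) \<Rightarrow> ('a \<Rightarrow> 'b) \<Rightarrow> bool" where
  "stratum_preserving_homotopic n X F Y G = homotopic_with (preserves_strata n F G) X Y"

definition stratum_preserving_homotopy_equivalence ::
    "nat \<Rightarrow> 'a topology \<Rightarrow> (nat \<Rightarrow> 'a set) \<Rightarrow> 'b topology \<Rightarrow> (nat \<Rightarrow> 'b set) \<Rightarrow> ('a \<Rightarrow> 'b) \<Rightarrow> bool" where
  "stratum_preserving_homotopy_equivalence n X F Y G f \<longleftrightarrow>
     stratum_preserving_map n X F Y G f \<and>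
     (\<exists>g. stratum_preserving_map n Y G X F g \<and>
          stratum_preserving_homotopic n X F X F (g \<circ> f) id \<and>
          stratum_preserving_homotopic n Y G Y G (f \<circ> g) id)"

definition neighborhood_in :: "'a topology \<Rightarrow> 'a set \<Rightarrow> 'a set \<Rightarrow> bool" where
  "neighborhood_in Y X N \<longleftrightarrow> N \<subseteq> topspace Y \<and> X \<subseteq> Y interior_of N"

section \<open>Path spaces and fibrations\<close>

text \<open>Maps are made canonical by being \<open>undefined\<close> outside the domain space.
  The choice \<open>K = {}\<close> makes the whole set of maps one of the generating sets.\<close>

definition compact_open_topology :: "'a topology \<Rightarrow> 'b topology \<Rightarrow> ('a \<Rightarrow> 'b) topology" where
  "compact_open_topology X Y =
     topology_generated_by
       {{f \<in> extensional (topspace X). continuous_map X Y f \<and> f ` K \<subseteq> U} | K U.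
          compactin X K \<and> openin Y U}"

definition holink :: "'a topology \<Rightarrow> 'a set \<Rightarrow> (real \<Rightarrow> 'a) topology" where
  "holink A B = subtopology (compact_open_topology unit_interval A)
     {w. w 0 \<in> B \<and> w ` {0<..1} \<subseteq> topspace A - B}"

text \<open>Homotopy lifting property. HOL cannot quantify over spaces \<open>Z\<close> of every type inside a
  definition; the type used here accommodates the universal lifting problem, that of
  \<open>{(e, \<gamma>). \<gamma> 0 = p e}\<close>, so that no generality is lost:
  see \<open>hurewicz_fibration_lifting\<close> below.\<close>

definition hurewicz_fibration :: "'e topology \<Rightarrow> 'b topology \<Rightarrow> ('e \<Rightarrow> 'b) \<Rightarrow> bool" where
  "hurewicz_fibration E B p \<longleftrightarrow> continuous_map E B p \<and>
     (\<forall>(Z :: ('e \<times> (real \<Rightarrow> 'b)) topology) f H.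
        continuous_map Z E f \<and> continuous_map (prod_topology Z unit_interval) B H \<and>
        (\<forall>z\<in>topspace Z. H (z, 0) = p (f z)) \<longrightarrow>
        (\<exists>G. continuous_map (prod_topology Z unit_interval) E G \<and>
             (\<forall>z\<in>topspace Z. G (z, 0) = f z) \<and>
             (\<forall>z\<in>topspace Z. \<forall>t\<in>{0..1}. p (G (z, t)) = H (z, t))))"

lemma topspace_compact_open_topology:
  "topspace (compact_open_topology X Y) =
     {f \<in> extensional (topspace X). continuous_map X Y f}"
  unfolding compact_open_topology_def topology_generated_by_topspace by auto

lemma openin_compact_open_topology:
  assumes "compactin X K" "openin Y U"
  shows "openin (compact_open_topology X Y)
     {f \<in> extensional (topspace X). continuous_map X Y f \<and> f ` K \<subseteq> U}"
  unfolding compact_open_topology_def using assms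
  by (intro topology_generated_by_Basis) blast

lemma continuous_map_path_eval:
  "continuous_map (prod_topology (compact_open_topology unit_interval B) unit_interval) B
     (\<lambda>(\<gamma>, t). \<gamma> t)"
proof -
  let ?C = "compact_open_topology unit_interval B"
  have "openin (prod_topology ?C unit_interval)
      {x \<in> topspace (prod_topology ?C unit_interval). (\<lambda>(\<gamma>, t). \<gamma> t) x \<in> U}" (is "openin _ ?S")
    if U: "openin B U" for U
  proof (subst openin_subopen, clarify)
    fix \<gamma> t
    assume "(\<gamma>, t) \<in> topspace (prod_topology ?C unit_interval)" "\<gamma> t \<in> U"
    then have \<gamma>: "\<gamma> \<in> extensional {0..1}" "continuous_map unit_interval B \<gamma>"
      and t: "t \<in> {0..1}" "\<gamma> t \<in> U"
      by (auto simp: topspace_compact_open_topology)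
    have "openin unit_interval {s \<in> topspace unit_interval. \<gamma> s \<in> U}"
      using \<gamma>(2) U openin_continuous_map_preimage by blast
    then obtain e where e: "e > 0" "\<And>s. s \<in> {0..1} \<Longrightarrow> dist s t < e \<Longrightarrow> \<gamma> s \<in> U"
      using t by (auto simp: openin_euclidean_subtopology_iff)
    define K where "K = {0..1} \<inter> cball t (e/2)"
    define V where "V = {0..1} \<inter> ball t (e/2)"
    define W where "W = {f \<in> extensional (topspace unit_interval).
      continuous_map unit_interval B f \<and> f ` K \<subseteq> U}"
    have K: "compactin unit_interval K"
      unfolding K_def by (simp add: compactin_subtopology compact_Int)
    have "openin ?C W"
      unfolding W_def by (rule openin_compact_open_topology[OF K U])
    moreover have "openin unit_interval V"
      unfolding V_def by (simp add: openin_open_Int)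
    moreover have "\<gamma> \<in> W"
      unfolding W_def K_def using \<gamma> e by (auto simp: dist_commute)
    moreover have "t \<in> V" unfolding V_def using t e by auto
    moreover have "W \<times> V \<subseteq> ?S"
      unfolding W_def V_def K_def by (auto simp: topspace_compact_open_topology)
    ultimately show "\<exists>T. openin (prod_topology ?C unit_interval) T \<and> (\<gamma>, t) \<in> T \<and> T \<subseteq> ?S"
      by (intro exI[of _ "W \<times> V"]) (auto simp: openin_prod_Times_iff)
  qed
  moreover have "(\<lambda>(\<gamma>, t). \<gamma> t) \<in> topspace (prod_topology ?C unit_interval) \<rightarrow> topspace B"
    by (auto simp: topspace_compact_open_topology continuous_map_def)
  ultimately show ?thesis unfolding continuous_map_def by blast
qed

lemma continuous_map_path_curry:
  assumes H: "continuous_map (prod_topology Z unit_interval) B H"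
  shows "continuous_map Z (compact_open_topology unit_interval B)
           (\<lambda>z. restrict (\<lambda>t. H (z, t)) {0..1})"
proof -
  define c where "c = (\<lambda>z. restrict (\<lambda>t. H (z, t)) {0..1::real})"
  have c: "c z \<in> extensional (topspace unit_interval) \<and> continuous_map unit_interval B (c z)"
    if z: "z \<in> topspace Z" for z
  proof
    have "continuous_map unit_interval B (H \<circ> (\<lambda>t. (z, t)))"
      using z by (intro continuous_map_compose[OF _ H] continuous_map_pairedI) auto
    then show "continuous_map unit_interval B (c z)"
      by (rule continuous_map_eq) (auto simp: c_def)
  qed (auto simp: c_def)
  have op: "openin Z {z \<in> topspace Z. c z ` K \<subseteq> U}"
    if K: "compactin unit_interval K" and U: "openin B U" for K U
  proof -
    let ?K = "subtopology unit_interval K"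
    let ?D = "{x \<in> topspace (prod_topology Z ?K). H x \<in> topspace B - U}"
    have K01: "K \<subseteq> {0..1}"
      using K compactin_subset_topspace by fastforce
    have eq: "prod_topology Z ?K = subtopology (prod_topology Z unit_interval) (topspace Z \<times> K)"
      by (rule prod_topology_subtopology(2))
    have HK: "continuous_map (prod_topology Z ?K) B H"
      unfolding eq by (rule continuous_map_from_subtopology[OF H])
    have "closedin (prod_topology Z ?K) ?D"
      using HK U by (intro closedin_continuous_map_preimage) auto
    moreover have "closed_map (prod_topology Z ?K) Z fst"
      using K by (intro Abstract_Topological_Spaces.closed_map_fst) (simp add: compactin_subspace)
    ultimately have "closedin Z (fst ` ?D)"
      by (simp add: closed_map_def)
    moreover have "c z ` K \<subseteq> U \<longleftrightarrow> z \<notin> fst ` ?D" if z: "z \<in> topspace Z" for z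
    proof -
      have "c z t = H (z, t)" "H (z, t) \<in> topspace B" if "t \<in> K" for t
        using z that K01 H by (auto simp: c_def continuous_map_def Pi_iff)
      then have "c z ` K \<subseteq> U \<longleftrightarrow> (\<forall>t\<in>K. H (z, t) \<notin> topspace B - U)"
        by auto
      moreover have "z \<in> fst ` ?D \<longleftrightarrow> (\<exists>t\<in>K. H (z, t) \<in> topspace B - U)"
      proof
        assume "\<exists>t\<in>K. H (z, t) \<in> topspace B - U"
        then obtain t where "t \<in> K" "H (z, t) \<in> topspace B - U" ..
        then have "(z, t) \<in> ?D" using z K01 by auto
        then show "z \<in> fst ` ?D" by (rule image_eqI[rotated]) simp
      qed auto
      ultimately show ?thesis by blast
    qed
    then have "{z \<in> topspace Z. c z ` K \<subseteq> U} = topspace Z - fst ` ?D"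
      by blast
    ultimately show ?thesis
      by (simp only: openin_diff[OF openin_topspace])
  qed
  have "continuous_map Z (compact_open_topology unit_interval B) c"
    unfolding compact_open_topology_def
  proof (rule continuous_on_generated_topo)
    fix V
    assume "V \<in> {{f \<in> extensional (topspace unit_interval).
      continuous_map unit_interval B f \<and> f ` K \<subseteq> U} | K U. compactin unit_interval K \<and> openin B U}"
    then obtain K U where KU: "compactin unit_interval K" "openin B U"
      and V: "V = {f \<in> extensional (topspace unit_interval).
                     continuous_map unit_interval B f \<and> f ` K \<subseteq> U}"
      by blast
    have "c -` V \<inter> topspace Z = {z \<in> topspace Z. c z ` K \<subseteq> U}"
      using c by (auto simp: V)
    then show "openin Z (c -` V \<inter> topspace Z)"
      using op[OF KU] by simp
  next
    show "c ` topspace Z \<subseteq> \<Union>{{f \<in> extensional (topspace unit_interval).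
      continuous_map unit_interval B f \<and> f ` K \<subseteq> U} | K U. compactin unit_interval K \<and> openin B U}"
      using c topspace_compact_open_topology[of unit_interval B]
      unfolding compact_open_topology_def topology_generated_by_topspace by blast
  qed
  then show ?thesis unfolding c_def .
qed

theorem hurewicz_fibration_lifting:
  fixes Z :: "'z topology"
  assumes fib: "hurewicz_fibration E B p"
    and f: "continuous_map Z E f"
    and H: "continuous_map (prod_topology Z unit_interval) B H"
    and Hf: "\<And>z. z \<in> topspace Z \<Longrightarrow> H (z, 0) = p (f z)"
  obtains G where "continuous_map (prod_topology Z unit_interval) E G"
    and "\<And>z. z \<in> topspace Z \<Longrightarrow> G (z, 0) = f z"
    and "\<And>z t. z \<in> topspace Z \<Longrightarrow> t \<in> {0..1} \<Longrightarrow> p (G (z, t)) = H (z, t)"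
proof -
  define W where "W = subtopology (prod_topology E (compact_open_topology unit_interval B))
    {(e, \<gamma>). \<gamma> 0 = p e}"
  have fstW: "continuous_map W E fst" and sndW: "continuous_map W (compact_open_topology unit_interval B) snd"
    unfolding W_def
    by (auto intro: continuous_map_from_subtopology continuous_map_fst continuous_map_snd)
  have "continuous_map (prod_topology W unit_interval) B ((\<lambda>(\<gamma>, t). \<gamma> t) \<circ> (\<lambda>x. (snd (fst x), snd x)))"
    using continuous_map_compose[OF continuous_map_fst sndW]
    by (intro continuous_map_compose[OF _ continuous_map_path_eval] continuous_map_pairedI
        continuous_map_snd) (auto simp: o_def)
  moreover have "\<forall>x\<in>topspace W. ((\<lambda>(\<gamma>, t). \<gamma> t) \<circ> (\<lambda>x. (snd (fst x), snd x))) (x, 0) = p (fst x)"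
    by (auto simp: W_def)
  ultimately have "\<exists>L. continuous_map (prod_topology W unit_interval) E L \<and>
    (\<forall>x\<in>topspace W. L (x, 0) = fst x) \<and>
    (\<forall>x\<in>topspace W. \<forall>t\<in>{0..1}. p (L (x, t)) =
       ((\<lambda>(\<gamma>, t). \<gamma> t) \<circ> (\<lambda>x. (snd (fst x), snd x))) (x, t))"
    using fib fstW unfolding hurewicz_fibration_def by blast
  then obtain L where L: "continuous_map (prod_topology W unit_interval) E L"
    "\<And>x. x \<in> topspace W \<Longrightarrow> L (x, 0) = fst x"
    "\<And>x t. x \<in> topspace W \<Longrightarrow> t \<in> {0..1} \<Longrightarrow> p (L (x, t)) = snd x t"
    by auto
  define k where "k = (\<lambda>z. (f z, restrict (\<lambda>t. H (z, t)) {0..1::real}))"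
  have k: "continuous_map Z W k"
    unfolding W_def k_def continuous_map_in_subtopology
    using f continuous_map_path_curry[OF H] Hf by (auto intro: continuous_map_pairedI)
  then have kW: "k z \<in> topspace W" if "z \<in> topspace Z" for z
    using that by (auto simp: continuous_map_def)
  show thesis
  proof
    show "continuous_map (prod_topology Z unit_interval) E (L \<circ> (\<lambda>x. (k (fst x), snd x)))"
      using continuous_map_compose[OF continuous_map_fst k]
      by (intro continuous_map_compose[OF _ L(1)] continuous_map_pairedI continuous_map_snd)
         (auto simp: o_def)
  qed (use L kW in \<open>auto simp: k_def\<close>)
qed

section \<open>Manifold weakly stratified spaces\<close>

definition tame :: "'a topology \<Rightarrow> 'a set \<Rightarrow> bool" where
  "tame A B \<longleftrightarrow> (\<exists>U h. neighborhood_in A B U \<and>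
     continuous_map (prod_topology (subtopology A U) unit_interval) A h \<and>
     (\<forall>x\<in>B. \<forall>t\<in>{0..1}. h (x, t) = x) \<and>
     (\<forall>x\<in>U. h (x, 1) = x) \<and>
     (\<forall>x\<in>U. h (x, 0) \<in> B) \<and>
     (\<forall>x\<in>U - B. \<forall>t\<in>{0<..1}. h (x, t) \<in> topspace A - B))"

definition weakly_stratified :: "'a topology \<Rightarrow> nat \<Rightarrow> (nat \<Rightarrow> 'a set) \<Rightarrow> bool" where
  "weakly_stratified Y n F \<longleftrightarrow> filtered_space Y n F \<and>
     (\<forall>i k. i < k \<and> k \<le> n \<longrightarrow>
        (let A = subtopology Y (stratum F k \<union> stratum F i); B = stratum F i
         in tame A B \<and> hurewicz_fibration (holink A B) (subtopology Y B) (\<lambda>w. w 0)))"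

text \<open>The dimension may depend on the component.\<close>

definition topological_manifold :: "'a topology \<Rightarrow> bool" where
  "topological_manifold M \<longleftrightarrow> Hausdorff_space M \<and> second_countable M \<and>
     (\<forall>x\<in>topspace M. \<exists>U m. openin M U \<and> x \<in> U \<and>
        subtopology M U homeomorphic_space Euclidean_space m)"

definition manifold_weakly_stratified :: "'a topology \<Rightarrow> nat \<Rightarrow> (nat \<Rightarrow> 'a set) \<Rightarrow> bool" where
  "manifold_weakly_stratified Y n F \<longleftrightarrow> weakly_stratified Y n F \<and>
     (\<forall>i\<le>n. topological_manifold (subtopology Y (stratum F i)))"

definition pure_subset :: "'a topology \<Rightarrow> nat \<Rightarrow> (nat \<Rightarrow> 'a set) \<Rightarrow> 'a set \<Rightarrow> bool" where
  "pure_subset Y n F X \<longleftrightarrow> closedin Y X \<and>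
     (\<exists>\<C> \<subseteq> (\<Union>i\<le>n. connected_components_of (subtopology Y (stratum F i))). X = \<Union>\<C>)"

section \<open>Deformation retractions and the stratified homotopy link\<close>

text \<open>In the following definitions \<open>N\<close> is a subspace of a space filtered by \<open>F\<close>, so that its
  strata are the sets \<open>topspace N \<inter> stratum F i\<close>.\<close>

definition nearly_sp_deformation_retraction ::
    "nat \<Rightarrow> (nat \<Rightarrow> 'a set) \<Rightarrow> 'a topology \<Rightarrow> 'a set \<Rightarrow> ('a \<times> real \<Rightarrow> 'a) \<Rightarrow> bool" where
  "nearly_sp_deformation_retraction n F N X R \<longleftrightarrow>
     continuous_map (prod_topology N unit_interval) N R \<and>
     (\<forall>y\<in>topspace N. R (y, 1) = y) \<and>
     (\<forall>x\<in>X. \<forall>t\<in>{0..1}. R (x, t) = x) \<and>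
     (\<forall>y\<in>topspace N. R (y, 0) \<in> X) \<and>
     (\<forall>i\<le>n. \<forall>y\<in>topspace N \<inter> stratum F i. \<forall>t\<in>{0<..1}. R (y, t) \<in> stratum F i) \<and>
     (\<forall>y\<in>topspace N - X. \<forall>t\<in>{0<..1}. R (y, t) \<notin> X)"

definition strat_holink ::
    "nat \<Rightarrow> (nat \<Rightarrow> 'a set) \<Rightarrow> 'a topology \<Rightarrow> 'a set \<Rightarrow> (real \<Rightarrow> 'a) topology" where
  "strat_holink n F N X =
     subtopology (holink N X) {w. \<exists>i\<le>n. w ` {0<..1} \<subseteq> stratum F i}"

definition strat_holink_filtration ::
    "nat \<Rightarrow> (nat \<Rightarrow> 'a set) \<Rightarrow> 'a topology \<Rightarrow> 'a set \<Rightarrow> nat \<Rightarrow> (real \<Rightarrow> 'a) set" where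
  "strat_holink_filtration n F N X j = {w \<in> topspace (strat_holink n F N X). w ` {0<..1} \<subseteq> F j}"

text \<open>The generating sets are a base, being closed under binary intersections when \<open>p\<close> is
  continuous. \<open>Inl\<close> is the inclusion of the target \<open>B\<close> of \<open>p\<close>.\<close>

definition teardrop_cylinder ::
    "'e topology \<Rightarrow> 'b topology \<Rightarrow> ('e \<Rightarrow> 'b) \<Rightarrow> ('b + 'e \<times> real) topology" where
  "teardrop_cylinder E B p = topology_generated_by
     ({Inr ` W | W. openin (prod_topology E (top_of_set {0<..1})) W} \<union>
      {Inr ` ({e \<in> topspace E. p e \<in> U} \<times> {0<..<\<epsilon>}) \<union> Inl ` U | U \<epsilon>.
         openin B U \<and> 0 < \<epsilon> \<and> \<epsilon> \<le> 1})"

definition holink_cylinder ::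
    "nat \<Rightarrow> (nat \<Rightarrow> 'a set) \<Rightarrow> 'a topology \<Rightarrow> 'a set \<Rightarrow> ('a + (real \<Rightarrow> 'a) \<times> real) topology" where
  "holink_cylinder n F N X =
     teardrop_cylinder (strat_holink n F N X) (subtopology N X) (\<lambda>w. w 0)"

definition holink_cylinder_filtration ::
    "nat \<Rightarrow> (nat \<Rightarrow> 'a set) \<Rightarrow> 'a topology \<Rightarrow> 'a set \<Rightarrow> nat \<Rightarrow> ('a + (real \<Rightarrow> 'a) \<times> real) set" where
  "holink_cylinder_filtration n F N X j =
     Inl ` (X \<inter> F j) \<union> Inr ` (strat_holink_filtration n F N X j \<times> {0<..1})"

end

theory Submission
  imports Defs
begin

text \<open>With \<open>\<delta> y = min 1 (dist y (R (y, 0)))\<close>, which vanishes exactly on \<open>X\<close>, the equivalence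
  \<open>N \<rightarrow> I\<^sub>\<pi>\<close> is the identity on \<open>X\<close> and sends \<open>y \<notin> X\<close> to \<open>(R (y, -), \<delta> y)\<close>. A teardrop
  neighborhood of a point of \<open>X\<close> does not control \<open>w t\<close>, so \<open>(w, t) \<mapsto> w t\<close> need not be
  continuous; the inverse is \<open>(w, t) \<mapsto> w (\<phi> (w, t))\<close> instead, for a continuous \<open>\<phi> > 0\<close> such that
  \<open>w\<close> stays within distance \<open>t\<close> of \<open>w 0\<close> on \<open>[0, \<phi> (w, t)]\<close>. One composite is
  \<open>y \<mapsto> R (y, \<sigma> y)\<close> with \<open>\<sigma> > 0\<close> off \<open>X\<close>, and is deformed by pushing \<open>\<sigma>\<close> to \<open>1\<close>. The other one is
  deformed through paths in the squares of points \<open>R (w a, b)\<close>.\<close>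

section \<open>Continuity criteria\<close>

text \<open>Compactness of the interval makes the infimum a minimum. Superlevel sets are then
  preimages of compact-open sets under currying, and sublevel sets are unions of open slices. This
  gives the continuity of \<open>reach\<close>.\<close>

lemma continuous_map_INF_unit_interval:
  fixes f :: "'z \<times> real \<Rightarrow> real"
  assumes f: "continuous_map (prod_topology Z unit_interval) euclideanreal f"
  shows "continuous_map Z euclideanreal (\<lambda>z. INF s\<in>{0..1}. f (z, s))"
    and "z \<in> topspace Z \<Longrightarrow>
      \<exists>s\<in>{0..1}. (INF s\<in>{0..1}. f (z, s)) = f (z, s) \<and> (\<forall>t\<in>{0..1}. f (z, s) \<le> f (z, t))"
proof -
  show att: "\<exists>s\<in>{0..1}. (INF s\<in>{0..1}. f (z, s)) = f (z, s) \<and> (\<forall>t\<in>{0..1}. f (z, s) \<le> f (z, t))"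
    if z: "z \<in> topspace Z" for z
  proof -
    have "continuous_map unit_interval euclideanreal (f \<circ> (\<lambda>t. (z, t)))"
      using z by (intro continuous_map_compose[OF _ f] continuous_map_pairedI) auto
    then have "continuous_on {0..1} (\<lambda>s. f (z, s))"
      by (simp add: o_def)
    then obtain s where s: "s \<in> {0..1}" "\<forall>t\<in>{0..1}. f (z, s) \<le> f (z, t)"
      using continuous_attains_inf[of "{0..1::real}" "\<lambda>s. f (z, s)"] by auto
    then have "(INF s\<in>{0..1}. f (z, s)) = f (z, s)"
      by (intro cInf_eq_minimum) auto
    with s show ?thesis by blast
  qed
  show "continuous_map Z euclideanreal (\<lambda>z. INF s\<in>{0..1}. f (z, s))"
    unfolding continuous_map_upper_lower_semicontinuous_lt
  proof (intro conjI allI)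
    fix a :: real
    let ?C = "compact_open_topology unit_interval euclideanreal"
    let ?V = "{g \<in> extensional (topspace unit_interval).
      continuous_map unit_interval euclideanreal g \<and> g ` {0..1} \<subseteq> {a<..}}"
    let ?c = "\<lambda>z. restrict (\<lambda>t. f (z, t)) {0..1::real}"
    have c: "continuous_map Z ?C ?c"
      by (rule continuous_map_path_curry[OF f])
    have "openin ?C ?V"
      by (rule openin_compact_open_topology) auto
    then have "openin Z {z \<in> topspace Z. ?c z \<in> ?V}"
      using c openin_continuous_map_preimage by blast
    moreover have "?c z \<in> ?V \<longleftrightarrow> (INF s\<in>{0..1}. f (z, s)) > a" if z: "z \<in> topspace Z" for z
    proof -
      obtain s where s: "s\<in>{0..1}" "(INF s\<in>{0..1}. f (z, s)) = f (z, s)" "\<forall>t\<in>{0..1}. f (z, s) \<le> f (z, t)"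
        using att[OF z] by blast
      have "?c z \<in> topspace ?C" using c z by (auto simp: continuous_map_def)
      then have "?c z \<in> ?V \<longleftrightarrow> (\<forall>t\<in>{0..1}. f (z, t) > a)"
        unfolding topspace_compact_open_topology by auto
      \<comment> \<open>A strict bound at the minimizer \<open>s\<close> is a strict bound
        everywhere; this is what passes strictness to the infimum.\<close>
      also have "\<dots> \<longleftrightarrow> f (z, s) > a" using s(1,3) by (meson less_le_trans)
      finally show ?thesis using s(2) by simp
    qed
    ultimately show "openin Z {z \<in> topspace Z. (INF s\<in>{0..1}. f (z, s)) > a}"
      by (simp cong: conj_cong)
  next
    fix a :: real
    have "openin Z {z \<in> topspace Z. f (z, s) < a}" if "s \<in> {0..1}" for s
    proof -
      have "continuous_map Z euclideanreal (f \<circ> (\<lambda>z. (z, s)))"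
        using that by (intro continuous_map_compose[OF _ f] continuous_map_pairedI) auto
      then show ?thesis
        unfolding continuous_map_upper_lower_semicontinuous_lt by simp
    qed
    then have "openin Z (\<Union>s\<in>{0..1}. {z \<in> topspace Z. f (z, s) < a})"
      by blast
    moreover have "(\<Union>s\<in>{0..1}. {z \<in> topspace Z. f (z, s) < a}) =
        {z \<in> topspace Z. (INF s\<in>{0..1}. f (z, s)) < a}" (is "?L = ?R")
    proof -
      have "(INF s\<in>{0..1}. f (z, s)) < a \<longleftrightarrow> (\<exists>s\<in>{0..1}. f (z, s) < a)" if "z \<in> topspace Z" for z
        using att[OF that] by (metis le_less_trans)
      then show ?thesis by blast
    qed
    ultimately show "openin Z {z \<in> topspace Z. (INF s\<in>{0..1}. f (z, s)) < a}"
      by simp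
  qed
qed

text \<open>Openness of \<open>V\<close> turns relatively open preimages into open ones, so only the
  points off \<open>V\<close> need neighborhoods. It serves maps that have a formula off
  \<open>X\<close> and are a projection over \<open>X\<close>.\<close>

lemma continuous_map_if_continuous_on_open:
  assumes op: "openin Z V"
    and f: "continuous_map (subtopology Z V) T f"
    and im: "\<And>z. z \<in> topspace Z - V \<Longrightarrow> f z \<in> topspace T"
    and nbhd: "\<And>z U. z \<in> topspace Z - V \<Longrightarrow> openin T U \<Longrightarrow> f z \<in> U \<Longrightarrow>
                 \<exists>W. openin Z W \<and> z \<in> W \<and> f ` W \<subseteq> U"
  shows "continuous_map Z T f"
  unfolding continuous_map_def
proof (intro conjI allI impI)
  have V: "V \<subseteq> topspace Z" using op by (rule openin_subset)
  then show "f \<in> topspace Z \<rightarrow> topspace T"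
    using f im by (auto simp: continuous_map_def)
  fix U assume U: "openin T U"
  have "openin (subtopology Z V) {z \<in> topspace (subtopology Z V). f z \<in> U}"
    using f U openin_continuous_map_preimage by blast
  then have o: "openin Z {z \<in> V. f z \<in> U}"
    using op V by (simp add: openin_open_subtopology Int_absorb1)
  show "openin Z {z \<in> topspace Z. f z \<in> U}"
  proof (subst openin_subopen, clarify)
    fix z assume z: "z \<in> topspace Z" "f z \<in> U"
    show "\<exists>W. openin Z W \<and> z \<in> W \<and> W \<subseteq> {z \<in> topspace Z. f z \<in> U}"
    proof (cases "z \<in> V")
      case True
      with o z V show ?thesis by (intro exI[of _ "{z \<in> V. f z \<in> U}"]) auto
    next
      case False
      then obtain W where "openin Z W" "z \<in> W" "f ` W \<subseteq> U"
        using nbhd[of z U] z U by auto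
      then show ?thesis using openin_subset by (intro exI[of _ W]) fastforce
    qed
  qed
qed

section \<open>The teardrop cylinder\<close>

text \<open>The collapse of the cylinder onto its target. Base, height and, at positive height, the
  \<open>E\<close>-coordinate are the coordinates in which continuity into the teardrop topology is
  tested.\<close>

definition cylinder_base :: "('e \<Rightarrow> 'b) \<Rightarrow> 'b + 'e \<times> real \<Rightarrow> 'b" where
  "cylinder_base p = case_sum id (\<lambda>(e, t). p e)"

definition cylinder_height :: "'b + 'e \<times> real \<Rightarrow> real" where
  "cylinder_height = case_sum (\<lambda>_. 0) snd"

lemma cylinder_base_simps [simp]:
  "cylinder_base p (Inl x) = x" "cylinder_base p (Inr (e, t)) = p e"
  by (auto simp: cylinder_base_def)

lemma cylinder_height_simps [simp]:
  "cylinder_height (Inl x) = 0" "cylinder_height (Inr y) = snd y"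
  by (auto simp: cylinder_height_def)

lemma openin_teardrop_cylinder_Inr:
  "openin (prod_topology E (top_of_set {0<..1})) W \<Longrightarrow> openin (teardrop_cylinder E B p) (Inr ` W)"
  unfolding teardrop_cylinder_def by (intro topology_generated_by_Basis) blast

lemma openin_teardrop_cylinder_base:
  "openin B U \<Longrightarrow> 0 < \<epsilon> \<Longrightarrow> \<epsilon> \<le> 1 \<Longrightarrow>
   openin (teardrop_cylinder E B p) (Inr ` ({e \<in> topspace E. p e \<in> U} \<times> {0<..<\<epsilon>}) \<union> Inl ` U)"
  unfolding teardrop_cylinder_def by (intro topology_generated_by_Basis) blast

lemma topspace_teardrop_cylinder:
  "topspace (teardrop_cylinder E B p) = Inl ` topspace B \<union> Inr ` (topspace E \<times> {0<..1})"
  (is "?L = ?R")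
proof
  show "?L \<subseteq> ?R"
  proof
    fix z assume "z \<in> ?L"
    then consider W where "openin (prod_topology E (top_of_set {0<..1})) W" "z \<in> Inr ` W"
      | U \<epsilon> where "openin B U" "\<epsilon> \<le> 1" "z \<in> Inr ` ({e \<in> topspace E. p e \<in> U} \<times> {0<..<\<epsilon>}) \<union> Inl ` U"
      unfolding teardrop_cylinder_def topology_generated_by_topspace by blast
    then show "z \<in> ?R"
    proof cases
      case 1
      then show ?thesis using openin_subset[OF 1(1)] by auto
    next
      case 2
      then show ?thesis using openin_subset[OF 2(1)] by auto
    qed
  qed
  show "?R \<subseteq> ?L"
  proof (intro Un_least)
    show "Inr ` (topspace E \<times> {0<..1}) \<subseteq> ?L"
      by (rule openin_subset[OF openin_teardrop_cylinder_Inr])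
         (auto simp: openin_prod_Times_iff)
    show "Inl ` topspace B \<subseteq> ?L"
      using openin_subset[OF openin_teardrop_cylinder_base[of B "topspace B" 1 E p]] by auto
  qed
qed

lemma continuous_map_cylinder_base:
  assumes p: "continuous_map E B p"
  shows "continuous_map (teardrop_cylinder E B p) B (cylinder_base p)"
  unfolding continuous_map_def
proof (intro conjI allI impI)
  show "cylinder_base p \<in> topspace (teardrop_cylinder E B p) \<rightarrow> topspace B"
    using p by (auto simp: topspace_teardrop_cylinder continuous_map_def)
  fix U assume U: "openin B U"
  let ?E = "{e \<in> topspace E. p e \<in> U}"
  have "openin E ?E" using p U openin_continuous_map_preimage by blast
  \<comment> \<open>The teardrop sets stop below height 1; this product set supplies the top
    level.\<close>
  then have "openin (teardrop_cylinder E B p) (Inr ` (?E \<times> {0<..1}))"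
    by (intro openin_teardrop_cylinder_Inr) (auto simp: openin_prod_Times_iff)
  moreover have "openin (teardrop_cylinder E B p) (Inr ` (?E \<times> {0<..<1}) \<union> Inl ` U)"
    by (rule openin_teardrop_cylinder_base[OF U]) auto
  moreover have "{z \<in> topspace (teardrop_cylinder E B p). cylinder_base p z \<in> U} =
    Inr ` (?E \<times> {0<..1}) \<union> (Inr ` (?E \<times> {0<..<1}) \<union> Inl ` U)"
    using openin_subset[OF U] by (auto simp: topspace_teardrop_cylinder)
  ultimately show "openin (teardrop_cylinder E B p)
      {z \<in> topspace (teardrop_cylinder E B p). cylinder_base p z \<in> U}"
    by (simp only: openin_Un)
qed

lemma continuous_map_cylinder_height:
  assumes p: "continuous_map E B p"
  shows "continuous_map (teardrop_cylinder E B p) euclideanreal cylinder_height"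
  unfolding continuous_map_upper_lower_semicontinuous_lt
proof (intro conjI allI)
  fix a :: real
  let ?T = "teardrop_cylinder E B p"
  show "openin ?T {z \<in> topspace ?T. cylinder_height z > a}"
  proof (cases "a < 0")
    case True
    then have "{z \<in> topspace ?T. cylinder_height z > a} = topspace ?T"
      by (auto simp: topspace_teardrop_cylinder)
    then show ?thesis by (simp only: openin_topspace)
  next
    case False
    then have "{z \<in> topspace ?T. cylinder_height z > a} = Inr ` (topspace E \<times> ({0<..1} \<inter> {a<..}))"
      by (auto simp: topspace_teardrop_cylinder)
    moreover have "openin ?T (Inr ` (topspace E \<times> ({0<..1} \<inter> {a<..})))"
      by (intro openin_teardrop_cylinder_Inr) (auto simp: openin_prod_Times_iff openin_open_Int)
    ultimately show ?thesis by simp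
  qed
  have E: "p e \<in> topspace B" if "e \<in> topspace E" for e
    using p that by (auto simp: continuous_map_def)
  show "openin ?T {z \<in> topspace ?T. cylinder_height z < a}"
  proof -
    \<comment> \<open>Since \<epsilon> \<le> 1 in the generating sets, only for \<open>0 < a\<close>
      and \<open>a \<le> 1\<close> is the sublevel set itself a teardrop set, the one over all of
      \<open>B\<close>.\<close>
    consider "a \<le> 0" | "0 < a" "a \<le> 1" | "1 < a" by linarith
    then show ?thesis
    proof cases
      case 1
      then have "{z \<in> topspace ?T. cylinder_height z < a} = {}"
        by (auto simp: topspace_teardrop_cylinder)
      then show ?thesis by (simp only: openin_empty)
    next
      case 2
      then have "{z \<in> topspace ?T. cylinder_height z < a} =
          Inr ` ({e \<in> topspace E. p e \<in> topspace B} \<times> {0<..<a}) \<union> Inl ` topspace B"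
        using E by (auto simp: topspace_teardrop_cylinder)
      then show ?thesis
        using openin_teardrop_cylinder_base[OF openin_topspace 2, where p = p] by simp
    next
      case 3
      then have "{z \<in> topspace ?T. cylinder_height z < a} = topspace ?T"
        by (auto simp: topspace_teardrop_cylinder)
      then show ?thesis by (simp only: openin_topspace)
    qed
  qed
qed

lemma continuous_map_cylinder_Inr_part:
  "continuous_map (subtopology (teardrop_cylinder E B p) {z. cylinder_height z > 0}) E (\<lambda>z. fst (projr z))"
  unfolding continuous_map_def
proof (intro conjI allI impI)
  let ?T = "teardrop_cylinder E B p"
  show "(\<lambda>z. fst (projr z)) \<in> topspace (subtopology ?T {z. cylinder_height z > 0}) \<rightarrow> topspace E"
    by (auto simp: topspace_teardrop_cylinder)
  fix U assume U: "openin E U"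
  have "openin ?T (Inr ` (U \<times> {0<..1}))"
    using U by (intro openin_teardrop_cylinder_Inr) (auto simp: openin_prod_Times_iff)
  moreover have "{z \<in> topspace (subtopology ?T {z. cylinder_height z > 0}). fst (projr z) \<in> U} =
      {z. cylinder_height z > 0} \<inter> Inr ` (U \<times> {0<..1})"
    using openin_subset[OF U] by (auto simp: topspace_teardrop_cylinder)
  ultimately show "openin (subtopology ?T {z. cylinder_height z > 0})
      {z \<in> topspace (subtopology ?T {z. cylinder_height z > 0}). fst (projr z) \<in> U}"
    by (simp only: openin_subtopology_Int2)
qed

text \<open>A teardrop set is cut out by conditions on base and height alone, while the other
  generating sets lie at positive height. Hence nothing is asked of the \<open>E\<close>-coordinate
  near the base.\<close>

lemma continuous_map_into_teardrop_cylinder: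
  fixes E :: "'e topology" and B :: "'b topology"
  assumes im: "h \<in> topspace Z \<rightarrow> topspace (teardrop_cylinder E B p)"
    and base: "continuous_map Z B (\<lambda>z. cylinder_base p (h z))"
    and height: "continuous_map Z euclideanreal (\<lambda>z. cylinder_height (h z))"
    and E: "continuous_map (subtopology Z {z. cylinder_height (h z) > 0}) E (\<lambda>z. fst (projr (h z)))"
  shows "continuous_map Z (teardrop_cylinder E B p) h"
proof -
  let ?P = "{z. cylinder_height (h z) > 0}"
  \<comment> \<open>Openness of the locus of positive height lets open sets of that subspace count
    as open in \<open>Z\<close>.\<close>
  have opP: "openin Z (topspace Z \<inter> ?P)"
    using height unfolding continuous_map_upper_lower_semicontinuous_lt
    by (simp add: Int_def)
  have EH: "continuous_map (subtopology Z ?P) (prod_topology E (top_of_set {0<..1}))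
      (\<lambda>z. (fst (projr (h z)), cylinder_height (h z)))"
    using im continuous_map_from_subtopology[OF height, of ?P]
    by (intro continuous_map_pairedI E)
       (auto simp: continuous_map_in_subtopology topspace_teardrop_cylinder Pi_iff)
  show ?thesis unfolding teardrop_cylinder_def
  proof (rule continuous_on_generated_topo)
    fix V :: "('b + 'e \<times> real) set"
    assume "V \<in> {Inr ` W | W. openin (prod_topology E (top_of_set {0<..1})) W} \<union>
      {Inr ` ({e \<in> topspace E. p e \<in> U} \<times> {0<..<\<epsilon>}) \<union> Inl ` U | U \<epsilon>.
         openin B U \<and> 0 < \<epsilon> \<and> \<epsilon> \<le> 1}"
    then consider W where "openin (prod_topology E (top_of_set {0<..1})) W" "V = Inr ` W"
      | U \<epsilon> where "openin B U" "0 < \<epsilon>" "\<epsilon> \<le> 1"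
          "V = Inr ` ({e \<in> topspace E. p e \<in> U} \<times> {0<..<\<epsilon>}) \<union> Inl ` U"
      by blast
    then show "openin Z (h -` V \<inter> topspace Z)"
    proof cases
      case 1
      let ?S = "{z \<in> topspace (subtopology Z ?P). (fst (projr (h z)), cylinder_height (h z)) \<in> W}"
      have "openin (subtopology Z ?P) ?S"
        using EH 1(1) openin_continuous_map_preimage by blast
      then have "openin Z ?S"
        using opP openin_trans_full[of Z "topspace Z \<inter> ?P" ?S] by (simp only: subtopology_restrict)
      moreover have "h z \<in> Inr ` W \<longleftrightarrow> cylinder_height (h z) > 0 \<and> (fst (projr (h z)), cylinder_height (h z)) \<in> W"
        if "z \<in> topspace Z" for z
      proof -
        have "h z \<in> topspace (teardrop_cylinder E B p)" using im that by auto
        then show ?thesis by (auto simp: topspace_teardrop_cylinder)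
      qed
      then have "h -` V \<inter> topspace Z = ?S"
        unfolding 1(2) by auto
      ultimately show ?thesis by simp
    next
      case 2
      have "openin Z {z \<in> topspace Z. cylinder_base p (h z) \<in> U}"
        using base 2(1) openin_continuous_map_preimage by blast
      moreover have "openin Z {z \<in> topspace Z. cylinder_height (h z) < \<epsilon>}"
        using height unfolding continuous_map_upper_lower_semicontinuous_lt by blast
      moreover have "h z \<in> V \<longleftrightarrow> cylinder_base p (h z) \<in> U \<and> cylinder_height (h z) < \<epsilon>"
        if "z \<in> topspace Z" for z
      proof -
        have "h z \<in> topspace (teardrop_cylinder E B p)" using im that by auto
        then show ?thesis unfolding 2(4) using 2(2) by (auto simp: topspace_teardrop_cylinder)
      qed
      then have "h -` V \<inter> topspace Z = {z \<in> topspace Z. cylinder_base p (h z) \<in> U} \<inter>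
          {z \<in> topspace Z. cylinder_height (h z) < \<epsilon>}"
        by auto
      ultimately show ?thesis by (simp add: openin_Int)
    qed
  next
    show "h ` topspace Z \<subseteq> \<Union>({Inr ` W | W. openin (prod_topology E (top_of_set {0<..1})) W} \<union>
      {Inr ` ({e \<in> topspace E. p e \<in> U} \<times> {0<..<\<epsilon>}) \<union> Inl ` U | U \<epsilon>.
         openin B U \<and> 0 < \<epsilon> \<and> \<epsilon> \<le> 1})"
      using im unfolding teardrop_cylinder_def topology_generated_by_topspace by blast
  qed
qed

section \<open>The homotopy equivalence\<close>

abbreviation interpolate :: "real \<Rightarrow> real \<Rightarrow> real \<Rightarrow> real" where
  "interpolate s a b \<equiv> (1 - s) * a + s * b"

lemma interpolate_unit_interval:
  "\<lbrakk>s \<in> {0..1}; a \<in> {0..1}; b \<in> {0..1}\<rbrakk> \<Longrightarrow> interpolate s a b \<in> {0..1}"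
  by (auto intro!: convex_bound_le)

text \<open>The combination is at least \<open>min a b\<close>, so positivity survives at both ends
  of the range of \<open>s\<close>.\<close>

lemma interpolate_pos:
  assumes "s \<in> {0..1}" "a \<in> {0<..1}" "b \<in> {0<..1}"
  shows "interpolate s a b \<in> {0<..1}"
proof -
  have "interpolate s a b \<ge> (1 - s) * min a b + s * min a b"
    using assms by (intro add_mono mult_left_mono) auto
  then have "interpolate s a b \<ge> min a b"
    by (simp add: algebra_simps)
  then show ?thesis
    using assms interpolate_unit_interval[of s a b] by auto
qed

lemma continuous_map_into_unit_interval:
  "continuous_map Z euclideanreal f \<Longrightarrow> (\<And>z. z \<in> topspace Z \<Longrightarrow> f z \<in> {0..1}) \<Longrightarrow>
   continuous_map Z unit_interval f"
  by (auto simp: continuous_map_in_subtopology)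

lemma continuous_map_from_unit_interval:
  "continuous_map Z unit_interval f \<Longrightarrow> continuous_map Z euclideanreal f"
  by (auto simp: continuous_map_in_subtopology)

lemma continuous_map_fst': "continuous_map Z T f \<Longrightarrow> continuous_map (prod_topology Z S) T (\<lambda>x. f (fst x))"
  using continuous_map_compose[OF continuous_map_fst, of Z T f S] by (simp add: o_def)

lemma continuous_map_snd': "continuous_map Z T f \<Longrightarrow> continuous_map (prod_topology S Z) T (\<lambda>x. f (snd x))"
  using continuous_map_compose[OF continuous_map_snd, of Z T f S] by (simp add: o_def)

lemma continuous_map_interpolate:
  assumes "continuous_map Z euclideanreal s" "continuous_map Z euclideanreal a"
    "continuous_map Z euclideanreal b"
  shows "continuous_map Z euclideanreal (\<lambda>z. interpolate (s z) (a z) (b z))"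
  using assms by (intro continuous_map_add continuous_map_real_mult continuous_map_diff) auto

text \<open>\<open>M\<close> stands for the neighborhood, with a metric inducing its subspace
  topology. The filtration \<open>F\<close> is that of the ambient space, so the strata of the
  neighborhood are the sets \<open>M \<inter> stratum F i\<close>.\<close>

locale nsp_retraction = Metric_space M d for M :: "'a set" and d +
  fixes n :: nat and F :: "nat \<Rightarrow> 'a set" and X :: "'a set" and R :: "'a \<times> real \<Rightarrow> 'a"
  assumes retraction: "nearly_sp_deformation_retraction n F mtopology X R"
    and X_subset: "X \<subseteq> M"
    and strata_cover: "M \<subseteq> (\<Union>i\<le>n. stratum F i)"
    and F_mono: "\<And>i j. i \<le> j \<Longrightarrow> j \<le> n \<Longrightarrow> F i \<subseteq> F j"
begin

abbreviation "H \<equiv> strat_holink n F mtopology X"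
abbreviation "Cyl \<equiv> holink_cylinder n F mtopology X"
abbreviation "CylF \<equiv> holink_cylinder_filtration n F mtopology X"
abbreviation "base \<equiv> cylinder_base (\<lambda>w::real \<Rightarrow> 'a. w 0)"

lemma R_cont: "continuous_map (prod_topology mtopology unit_interval) mtopology R"
  and R_1: "y \<in> M \<Longrightarrow> R (y, 1) = y"
  and R_X: "x \<in> X \<Longrightarrow> t \<in> {0..1} \<Longrightarrow> R (x, t) = x"
  and R_0: "y \<in> M \<Longrightarrow> R (y, 0) \<in> X"
  and R_stratum: "i \<le> n \<Longrightarrow> y \<in> M \<Longrightarrow> y \<in> stratum F i \<Longrightarrow> t \<in> {0<..1} \<Longrightarrow> R (y, t) \<in> stratum F i"
  and R_notin: "y \<in> M \<Longrightarrow> y \<notin> X \<Longrightarrow> t \<in> {0<..1} \<Longrightarrow> R (y, t) \<notin> X"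
  using retraction unfolding nearly_sp_deformation_retraction_def by auto

lemma R_in: "y \<in> M \<Longrightarrow> t \<in> {0..1} \<Longrightarrow> R (y, t) \<in> M"
  using R_cont by (auto simp: continuous_map_def)

lemma continuous_map_R:
  assumes "continuous_map Z mtopology f" "continuous_map Z unit_interval g"
  shows "continuous_map Z mtopology (\<lambda>z. R (f z, g z))"
  using continuous_map_compose[OF continuous_map_pairedI[OF assms] R_cont] by (simp add: o_def)

lemma continuous_map_dist:
  assumes "continuous_map Z mtopology f" "continuous_map Z mtopology g"
  shows "continuous_map Z euclideanreal (\<lambda>z. d (f z) (g z))"
  using continuous_map_mdist[of Z "metric (M, d)" f g] assms
  by (simp add: mtopology_of_def)

subsection \<open>Stratified homotopy link\<close>

lemma in_H_iff:
  "w \<in> topspace H \<longleftrightarrow> w \<in> extensional {0..1} \<and> continuous_map unit_interval mtopology w \<and>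
     w 0 \<in> X \<and> (\<forall>t\<in>{0<..1}. w t \<in> M - X) \<and> (\<exists>i\<le>n. \<forall>t\<in>{0<..1}. w t \<in> stratum F i)"
  by (auto simp: strat_holink_def holink_def topspace_compact_open_topology)

lemma H_in_M: "w \<in> topspace H \<Longrightarrow> t \<in> {0..1} \<Longrightarrow> w t \<in> M"
  by (auto simp: in_H_iff continuous_map_def)

lemma continuous_map_H_eval:
  assumes w: "continuous_map Z H w" and t: "continuous_map Z unit_interval t"
  shows "continuous_map Z mtopology (\<lambda>z. w z (t z))"
proof -
  have "continuous_map Z (compact_open_topology unit_interval mtopology) w"
    using w unfolding strat_holink_def holink_def by (simp add: continuous_map_in_subtopology)
  from continuous_map_compose[OF continuous_map_pairedI[OF this t] continuous_map_path_eval]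
  show ?thesis by (simp add: o_def)
qed

lemma continuous_map_H_curry:
  assumes f: "continuous_map (prod_topology Z unit_interval) mtopology (\<lambda>x. f (fst x) (snd x))"
    and "\<And>z. z \<in> topspace Z \<Longrightarrow> restrict (f z) {0..1} \<in> topspace H"
  shows "continuous_map Z H (\<lambda>z. restrict (f z) {0..1})"
  using continuous_map_path_curry[OF f] assms(2)
  unfolding strat_holink_def holink_def
  by (auto simp: continuous_map_in_subtopology restrict_def)

lemma restrict_in_H:
  assumes f: "continuous_map unit_interval mtopology f"
    and "f 0 \<in> X" "\<And>t. t \<in> {0<..1} \<Longrightarrow> f t \<notin> X"
    and i: "i \<le> n" "\<And>t. t \<in> {0<..1} \<Longrightarrow> f t \<in> stratum F i"
  shows "restrict f {0..1} \<in> topspace H"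
  unfolding in_H_iff
proof (intro conjI ballI)
  show "continuous_map unit_interval mtopology (restrict f {0..1})"
    using f by (rule continuous_map_eq) auto
  show "\<exists>i\<le>n. \<forall>t\<in>{0<..1}. restrict f {0..1} t \<in> stratum F i"
    using i by (intro exI[of _ i]) auto
qed (use assms in \<open>auto simp: continuous_map_def Pi_iff\<close>)

lemma continuous_map_H_0: "continuous_map H (subtopology mtopology X) (\<lambda>w. w 0)"
  using continuous_map_H_eval[of H "\<lambda>w. w" "\<lambda>_. 0"]
  by (auto simp: continuous_map_in_subtopology in_H_iff)

subsection \<open>The mapping cylinder\<close>

lemma topspace_Cyl: "topspace Cyl = Inl ` X \<union> Inr ` (topspace H \<times> {0<..1})"
  using X_subset by (auto simp: holink_cylinder_def topspace_teardrop_cylinder)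

lemma continuous_map_base: "continuous_map Cyl mtopology base"
  using continuous_map_cylinder_base[OF continuous_map_H_0]
  by (auto simp: holink_cylinder_def continuous_map_in_subtopology)

lemma continuous_map_height: "continuous_map Cyl euclideanreal cylinder_height"
  unfolding holink_cylinder_def by (rule continuous_map_cylinder_height[OF continuous_map_H_0])

lemma continuous_map_Inr_part:
  "continuous_map (subtopology Cyl {z. cylinder_height z > 0}) H (\<lambda>z. fst (projr z))"
  unfolding holink_cylinder_def by (rule continuous_map_cylinder_Inr_part)

lemma openin_height_pos: "openin Cyl {z \<in> topspace Cyl. cylinder_height z > 0}"
  using continuous_map_height unfolding continuous_map_upper_lower_semicontinuous_lt by blast

text \<open>The base may be tested in \<open>mtopology\<close> rather than in the subspace
  \<open>X\<close>, because points of the cylinder have their base in \<open>X\<close>.\<close>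

lemma continuous_map_into_Cyl:
  assumes im: "h \<in> topspace Z \<rightarrow> topspace Cyl"
    and base: "continuous_map Z mtopology (\<lambda>z. base (h z))"
    and height: "continuous_map Z euclideanreal (\<lambda>z. cylinder_height (h z))"
    and H: "continuous_map (subtopology Z {z. cylinder_height (h z) > 0}) H (\<lambda>z. fst (projr (h z)))"
  shows "continuous_map Z Cyl h"
  unfolding holink_cylinder_def
proof (rule continuous_map_into_teardrop_cylinder[OF _ _ height H])
  show "h \<in> topspace Z \<rightarrow> topspace (teardrop_cylinder H (subtopology mtopology X) (\<lambda>w. w 0))"
    using im by (simp add: holink_cylinder_def)
  have "base (h z) \<in> X" if "z \<in> topspace Z" for z
  proof -
    have "h z \<in> topspace Cyl" using im that by auto
    then show ?thesis by (auto simp: topspace_Cyl in_H_iff)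
  qed
  then show "continuous_map Z (subtopology mtopology X) (\<lambda>z. base (h z))"
    using base by (auto simp: continuous_map_in_subtopology)
qed

section \<open>Strata of the mapping cylinder\<close>

lemma Inl_in_stratum_Cyl: "Inl x \<in> stratum CylF i \<longleftrightarrow> x \<in> X \<and> x \<in> stratum F i"
  by (auto simp: stratum_def holink_cylinder_filtration_def)

text \<open>The filtration only records that a path lies in \<open>F i\<close> and not wholly in
  \<open>F (i - 1)\<close>. As the path lies in one stratum, of index \<open>k\<close> say,
  monotonicity of \<open>F\<close> forces \<open>k = i\<close>.\<close>

lemma Inr_in_stratum_Cyl:
  assumes i: "i \<le> n"
  shows "Inr (w, t) \<in> stratum CylF i \<longleftrightarrow>
    w \<in> topspace H \<and> t \<in> {0<..1} \<and> (\<forall>u\<in>{0<..1}. w u \<in> stratum F i)" (is "?L \<longleftrightarrow> ?R")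
proof
  assume L: ?L
  then have w: "w \<in> topspace H" "t \<in> {0<..1}" "w ` {0<..1} \<subseteq> F i"
    "i = 0 \<or> \<not> w ` {0<..1} \<subseteq> F (i - 1)"
    by (auto simp: stratum_def holink_cylinder_filtration_def strat_holink_filtration_def split: if_splits)
  obtain k where k: "k \<le> n" "\<forall>t\<in>{0<..1}. w t \<in> stratum F k"
    using w(1) by (auto simp: in_H_iff)
  have "k = i"
  proof (rule ccontr)
    assume "k \<noteq> i"
    then consider "k < i" | "i < k" by linarith
    then show False
    proof cases
      case 1
      then have "F k \<subseteq> F (i - 1)" using i by (intro F_mono) auto
      then show False using w(4) k(2) 1 by (auto simp: stratum_def)
    next
      case 2
      then have "F i \<subseteq> F (k - 1)" using k by (intro F_mono) auto
      moreover have "w 1 \<in> F i" "w 1 \<in> stratum F k" using w(3) k by auto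
      ultimately show False using 2 by (auto simp: stratum_def)
    qed
  qed
  then show ?R using w k by auto
next
  assume R: ?R
  \<comment> \<open>The endpoint witnesses that the path is not contained in
    \<open>F (i - 1)\<close>.\<close>
  then have "w 1 \<in> stratum F i" by auto
  then show ?L using R
    by (auto simp: stratum_def holink_cylinder_filtration_def strat_holink_filtration_def)
qed

subsection \<open>The two maps\<close>

text \<open>The function \<delta>, cut off at 1 because heights in the cylinder do not exceed
  1.\<close>

definition gap :: "'a \<Rightarrow> real" where
  "gap y = min 1 (d y (R (y, 0)))"

lemma continuous_map_gap: "continuous_map Z mtopology f \<Longrightarrow> continuous_map Z euclideanreal (\<lambda>z. gap (f z))"
  unfolding gap_def
  by (intro continuous_map_real_min continuous_map_dist continuous_map_R) auto

lemma gap_X: "x \<in> X \<Longrightarrow> gap x = 0"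
  using X_subset by (auto simp: gap_def R_X)

lemma gap_pos: "y \<in> M \<Longrightarrow> y \<notin> X \<Longrightarrow> gap y \<in> {0<..1}"
  using R_0[of y] R_in[of y 0] mdist_pos_eq[of y "R (y, 0)"]
  by (auto simp: gap_def)

definition track :: "'a \<Rightarrow> real \<Rightarrow> 'a" where
  "track y = restrict (\<lambda>t. R (y, t)) {0..1}"

lemma continuous_R_path: "y \<in> M \<Longrightarrow> continuous_map unit_interval mtopology (\<lambda>t. R (y, t))"
  by (intro continuous_map_R) auto

text \<open>The strata cover \<open>M\<close>, and at positive times the retraction keeps
  \<open>y\<close> in its stratum and off \<open>X\<close>; at time 0 it lands in
  \<open>X\<close>.\<close>

lemma track_in_H:
  assumes "y \<in> M" "y \<notin> X"
  shows "track y \<in> topspace H"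
proof -
  obtain i where "i \<le> n" "y \<in> stratum F i" using strata_cover assms by auto
  then show ?thesis
    unfolding track_def using assms
    by (intro restrict_in_H[where i = i] continuous_R_path) (simp_all add: R_0 R_notin R_stratum)
qed

lemma continuous_map_track:
  assumes f: "continuous_map Z mtopology f" and X: "\<And>z. z \<in> topspace Z \<Longrightarrow> f z \<notin> X"
  shows "continuous_map Z H (\<lambda>z. track (f z))"
  unfolding track_def
proof (rule continuous_map_H_curry)
  show "continuous_map (prod_topology Z unit_interval) mtopology (\<lambda>x. R (f (fst x), snd x))"
    by (intro continuous_map_R continuous_map_fst' f continuous_map_snd)
  fix z assume "z \<in> topspace Z"
  then show "(\<lambda>t\<in>{0..1}. R (f z, t)) \<in> topspace H"
    using X track_in_H[of "f z"] continuous_map_funspace[OF f] by (simp add: track_def Pi_iff)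
qed

definition to_cylinder :: "'a \<Rightarrow> 'a + (real \<Rightarrow> 'a) \<times> real" where
  "to_cylinder y = (if y \<in> X then Inl y else Inr (track y, gap y))"

lemma base_to_cylinder: "y \<in> M \<Longrightarrow> base (to_cylinder y) = R (y, 0)"
  by (auto simp: to_cylinder_def track_def R_X)

lemma height_to_cylinder: "y \<in> M \<Longrightarrow> cylinder_height (to_cylinder y) = gap y"
  by (auto simp: to_cylinder_def gap_X)

text \<open>Base and height are \<open>R (y, 0)\<close> and \<open>gap y\<close>, continuous across
  \<open>X\<close>; the path \<open>track y\<close> has to vary continuously only off
  \<open>X\<close>, where currying \<open>R\<close> suffices.\<close>

lemma continuous_map_to_cylinder: "continuous_map mtopology Cyl to_cylinder"
proof (rule continuous_map_into_Cyl)
  show "to_cylinder \<in> topspace mtopology \<rightarrow> topspace Cyl"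
  proof
    fix y assume "y \<in> topspace mtopology"
    then show "to_cylinder y \<in> topspace Cyl"
      using track_in_H[of y] gap_pos[of y] by (simp add: to_cylinder_def topspace_Cyl image_iff)
  qed
  have "continuous_map mtopology mtopology (\<lambda>y. R (y, 0))"
    by (intro continuous_map_R) auto
  then show "continuous_map mtopology mtopology (\<lambda>y. base (to_cylinder y))"
    by (rule continuous_map_eq) (simp add: base_to_cylinder)
  have "continuous_map mtopology euclideanreal (\<lambda>y. gap y)"
    by (intro continuous_map_gap) auto
  then show "continuous_map mtopology euclideanreal (\<lambda>y. cylinder_height (to_cylinder y))"
    by (rule continuous_map_eq) (simp add: height_to_cylinder)
  let ?S = "subtopology mtopology {y. cylinder_height (to_cylinder y) > 0}"
  have S: "y \<notin> X" if "y \<in> topspace ?S" for y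
    using that by (simp add: to_cylinder_def split: if_splits)
  have "continuous_map ?S H (\<lambda>y. track y)"
    by (rule continuous_map_track) (use S in simp_all)
  then show "continuous_map ?S H (\<lambda>y. fst (projr (to_cylinder y)))"
  proof (rule continuous_map_eq)
    fix y assume "y \<in> topspace ?S"
    from S[OF this] show "track y = fst (projr (to_cylinder y))"
      by (simp add: to_cylinder_def)
  qed
qed

section \<open>A continuous parameter bound for paths and the inverse map\<close>

text \<open>The function \<phi>. Where \<open>s\<close> is below the infimum, the maximum must come
  from \<open>t - d (w 0) (w s)\<close>, which is then positive. An infimum is used because, unlike
  a first exit time, it depends continuously on \<open>(w, t)\<close>.\<close>

definition reach :: "(real \<Rightarrow> 'a) \<times> real \<Rightarrow> real" where
  "reach = (\<lambda>(w, t). (INF s\<in>{0..1}. max s (t - d (w 0) (w s))) / 2)"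

lemma reach_aux:
  "continuous_map (prod_topology (prod_topology H euclideanreal) unit_interval) euclideanreal
     (\<lambda>x. max (snd x) (snd (fst x) - d (fst (fst x) 0) (fst (fst x) (snd x))))"
proof -
  have [simp]: "continuous_map (prod_topology (prod_topology H euclideanreal) unit_interval) H (\<lambda>x. fst (fst x))"
    by (intro continuous_map_fst' continuous_map_fst)
  show ?thesis
    by (intro continuous_map_real_max continuous_map_diff continuous_map_dist continuous_map_H_eval
        continuous_map_fst' continuous_map_snd continuous_map_from_unit_interval[OF continuous_map_snd])
      auto
qed

lemma continuous_map_reach:
  assumes "continuous_map Z H w" "continuous_map Z euclideanreal t"
  shows "continuous_map Z euclideanreal (\<lambda>z. reach (w z, t z))"
proof -
  have "continuous_map (prod_topology H euclideanreal) euclideanreal reach"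
    using continuous_map_INF_unit_interval(1)[OF reach_aux]
    unfolding reach_def case_prod_unfold
    by (intro continuous_map_real_divide) auto
  from continuous_map_compose[OF continuous_map_pairedI[OF assms] this]
  show ?thesis by (simp add: o_def)
qed

text \<open>The minimum is attained at some \<open>s\<close>: the value is at least \<open>t\<close>
  if \<open>s = 0\<close> and at least \<open>s\<close> otherwise, hence positive. Testing at
  parameter 0 bounds \<open>2 * reach (w, t)\<close> by \<open>t\<close>, so by 1.\<close>

lemma
  assumes w: "w \<in> topspace H" and t: "t \<in> {0<..1}"
  shows reach_in: "reach (w, t) \<in> {0<..1}"
    and dist_reach: "a \<in> {0..reach (w, t)} \<Longrightarrow> d (w 0) (w a) < t"
proof -
  have wt: "(w, t) \<in> topspace (prod_topology H euclideanreal)"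
    using w by simp
  obtain s where s: "s \<in> {0..1}"
    "2 * reach (w, t) = max s (t - d (w 0) (w s))"
    "\<forall>u\<in>{0..1}. 2 * reach (w, t) \<le> max u (t - d (w 0) (w u))"
    using continuous_map_INF_unit_interval(2)[OF reach_aux wt] unfolding reach_def by auto
  have "w 0 \<in> M" using w H_in_M by auto
  then have pos: "reach (w, t) > 0"
    using s(1,2) t by (cases "s = 0") auto
  moreover have "2 * reach (w, t) \<le> max 0 (t - d (w 0) (w 0))"
    using s(3) by auto
  moreover have "t - d (w 0) (w 0) \<le> 1"
    using t nonneg[of "w 0" "w 0"] by (simp del: nonneg)
  ultimately show "reach (w, t) \<in> {0<..1}"
    by auto
  assume a: "a \<in> {0..reach (w, t)}"
  \<comment> \<open>The factor 1/2 in \<open>reach\<close> makes this strict, so \<open>a\<close>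
    cannot be the larger entry of the maximum below.\<close>
  then have "a < 2 * reach (w, t)" using pos by auto
  moreover have "2 * reach (w, t) \<le> max a (t - d (w 0) (w a))"
    using s(3) a \<open>reach (w, t) \<in> {0<..1}\<close> by auto
  ultimately show "d (w 0) (w a) < t" using pos a by auto
qed

text \<open>At \<open>a = 1\<close> this is the homotopy inverse, at \<open>a = 0\<close> the
  collapse to the base; the stages between them carry the base points during the homotopy on the
  cylinder.\<close>

definition slide :: "real \<Rightarrow> 'a + (real \<Rightarrow> 'a) \<times> real \<Rightarrow> 'a" where
  "slide a = case_sum id (\<lambda>(w, t). w (a * reach (w, t)))"

lemma slide_simps [simp]: "slide a (Inl x) = x" "slide a (Inr (w, t)) = w (a * reach (w, t))"
  by (auto simp: slide_def)

lemma mult_reach_in: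
  "w \<in> topspace H \<Longrightarrow> t \<in> {0<..1} \<Longrightarrow> a \<in> {0..1} \<Longrightarrow> a * reach (w, t) \<in> {0..reach (w, t)}"
  using reach_in[of w t] by (auto intro: mult_left_le_one_le)

lemma mult_reach_unit_interval:
  "w \<in> topspace H \<Longrightarrow> t \<in> {0<..1} \<Longrightarrow> a \<in> {0..1} \<Longrightarrow> a * reach (w, t) \<in> {0..1}"
  using mult_reach_in[of w t a] reach_in[of w t] by (meson atLeastAtMost_iff greaterThanAtMost_iff order_trans)

lemma slide_in:
  assumes "z \<in> topspace Cyl" "a \<in> {0..1}" shows "slide a z \<in> M"
proof -
  have "w (a * reach (w, t)) \<in> M" if "w \<in> topspace H" "t \<in> {0<..1}" for w t
    using mult_reach_unit_interval[OF that assms(2)] H_in_M[OF that(1)] by blast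
  then show ?thesis
    using assms X_subset by (auto simp: topspace_Cyl)
qed

text \<open>The control needed at the base: evaluation is confined to parameters up to
  \<open>reach\<close>. Equality can occur on \<open>Inl\<close>, where both sides are 0.\<close>

lemma dist_slide:
  assumes "z \<in> topspace Cyl" "a \<in> {0..1}" 
  shows "d (base z) (slide a z) \<le> cylinder_height z"
proof -
  consider x where "z = Inl x" "x \<in> X" | w t where "z = Inr (w, t)" "w \<in> topspace H" "t \<in> {0<..1}"
    using assms by (auto simp: topspace_Cyl)
  then show ?thesis
  proof cases
    case 1
    then show ?thesis using X_subset by auto
  next
    case 2
    then show ?thesis using dist_reach[OF 2(2,3) mult_reach_in[OF 2(2,3) assms(2)]] by simp
  qed
qed

text \<open>At positive height this is evaluation of paths. Near a point \<open>y\<close> of the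
  base, both \<open>d y (base z)\<close> and the height of \<open>z\<close> are small, and the
  triangle inequality bounds \<open>d y (slide a z)\<close> uniformly in \<open>a\<close>.\<close>

lemma continuous_map_slide_aux:
  "continuous_map (prod_topology unit_interval Cyl) mtopology (\<lambda>x. slide (fst x) (snd x))"
proof (rule continuous_map_if_continuous_on_open)
  let ?Z = "prod_topology unit_interval Cyl"
  let ?V = "{0..1} \<times> {z \<in> topspace Cyl. cylinder_height z > 0}"
  let ?S = "subtopology ?Z ?V"
  show "openin ?Z ?V"
    using openin_height_pos by (auto simp: openin_prod_Times_iff)
  have "continuous_map ?S (subtopology Cyl {z. cylinder_height z > 0}) snd"
    by (auto simp: continuous_map_in_subtopology continuous_map_from_subtopology continuous_map_snd)
  from continuous_map_compose[OF this continuous_map_Inr_part]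
  have w: "continuous_map ?S H (\<lambda>x. fst (projr (snd x)))" by (simp add: o_def)
  have "continuous_map ?Z euclideanreal fst"
    using continuous_map_from_unit_interval[OF continuous_map_fst] by blast
  then have a: "continuous_map ?S euclideanreal fst"
    by (rule continuous_map_from_subtopology)
  have t: "continuous_map ?S euclideanreal (\<lambda>x. cylinder_height (snd x))"
    by (intro continuous_map_from_subtopology continuous_map_snd' continuous_map_height)
  have "continuous_map ?S mtopology
    (\<lambda>x. fst (projr (snd x)) (fst x * reach (fst (projr (snd x)), cylinder_height (snd x))))"
  proof (intro continuous_map_H_eval w continuous_map_into_unit_interval continuous_map_real_mult a
      continuous_map_reach t)
    fix x assume "x \<in> topspace ?S"
    then show "fst x * reach (fst (projr (snd x)), cylinder_height (snd x)) \<in> {0..1}"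
      using mult_reach_unit_interval[of "fst (projr (snd x))" "cylinder_height (snd x)" "fst x"]
      by (auto simp: topspace_Cyl)
  qed
  then show "continuous_map ?S mtopology (\<lambda>x. slide (fst x) (snd x))"
    by (rule continuous_map_eq) (auto simp: topspace_Cyl)
  fix x assume "x \<in> topspace ?Z - ?V"
  then obtain a y where x: "x = (a, Inl y)" "a \<in> {0..1}" "y \<in> X"
    by (auto simp: topspace_Cyl)
  then show "slide (fst x) (snd x) \<in> topspace mtopology" using X_subset by auto
  fix U assume U: "openin mtopology U" "slide (fst x) (snd x) \<in> U"
  then obtain r where r: "r > 0" "mball y r \<subseteq> U"
    using x by (auto simp: openin_mtopology)
  let ?W1 = "{z \<in> topspace Cyl. base z \<in> mball y (r/2)}"
  let ?W2 = "{z \<in> topspace Cyl. cylinder_height z < r/2}"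
  have "openin Cyl ?W1"
    using continuous_map_base openin_mball openin_continuous_map_preimage by blast
  moreover have "openin Cyl ?W2"
    using continuous_map_height unfolding continuous_map_upper_lower_semicontinuous_lt by blast
  ultimately have "openin ?Z ({0..1} \<times> (?W1 \<inter> ?W2))"
    by (simp add: openin_prod_Times_iff openin_Int)
  moreover have "x \<in> {0..1} \<times> (?W1 \<inter> ?W2)"
    using x r X_subset by (auto simp: topspace_Cyl)
  moreover have "slide a z \<in> U" if a: "a \<in> {0..1}" and z: "z \<in> ?W1 \<inter> ?W2" for a z
  proof -
    have "base z \<in> M" "y \<in> M" "slide a z \<in> M" using z a x slide_in by auto
    then have "d y (slide a z) \<le> d y (base z) + d (base z) (slide a z)"
      using triangle by blast
    also have "\<dots> < r/2 + r/2"
      using z dist_slide[of z a] a by (intro add_strict_mono) auto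
    finally show ?thesis using r \<open>y \<in> M\<close> \<open>slide a z \<in> M\<close> by auto
  qed
  ultimately show "\<exists>W. openin ?Z W \<and> x \<in> W \<and> (\<lambda>x. slide (fst x) (snd x)) ` W \<subseteq> U"
    by (intro exI[of _ "{0..1} \<times> (?W1 \<inter> ?W2)"]) auto
qed

lemma continuous_map_slide:
  assumes "continuous_map Z unit_interval a" "continuous_map Z Cyl f"
  shows "continuous_map Z mtopology (\<lambda>z. slide (a z) (f z))"
  using continuous_map_compose[OF continuous_map_pairedI[OF assms] continuous_map_slide_aux]
  by (simp add: o_def)

subsection \<open>The two homotopies\<close>

text \<open>At \<open>s = 0\<close> this is the time \<sigma> of the composite, at
  \<open>s = 1\<close> it is 1. On \<open>X\<close> any time in the half-open interval would do,
  since \<open>R\<close> fixes \<open>X\<close>; no continuity of \<open>settle\<close> across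
  \<open>X\<close> is claimed.\<close>

definition settle :: "real \<Rightarrow> 'a \<Rightarrow> real" where
  "settle s y = (if y \<in> X then 1 else interpolate s (reach (track y, gap y)) 1)"

lemma settle_pos:
  assumes "s \<in> {0..1}" "y \<in> M"
  shows "settle s y \<in> {0<..1}"
proof (cases "y \<in> X")
  case False
  have "interpolate s (reach (track y, gap y)) 1 \<in> {0<..1}"
    using False assms by (intro interpolate_pos reach_in track_in_H gap_pos) simp_all
  then show ?thesis using False by (simp add: settle_def)
qed (simp add: settle_def)

lemma settle_unit_interval: "s \<in> {0..1} \<Longrightarrow> y \<in> M \<Longrightarrow> settle s y \<in> {0..1}"
  using settle_pos[of s y] by simp

text \<open>At a point of \<open>X\<close> the whole track is constant, so by compactness of the
  interval the entire tracks of nearby points stay in \<open>U\<close>, whatever time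
  \<open>settle\<close> selects.\<close>

lemma homotopy_on_space:
  "continuous_map (prod_topology unit_interval mtopology) mtopology (\<lambda>x. R (snd x, settle (fst x) (snd x)))"
proof (rule continuous_map_if_continuous_on_open)
  let ?Z = "prod_topology unit_interval mtopology"
  let ?V = "{0..1} \<times> {y \<in> M. gap y > 0}"
  let ?S = "subtopology ?Z ?V"
  have "continuous_map mtopology euclideanreal gap"
    using continuous_map_gap[of mtopology "\<lambda>y. y"] by simp
  then have "openin mtopology {y \<in> M. gap y > 0}"
    unfolding continuous_map_upper_lower_semicontinuous_lt by simp
  then show "openin ?Z ?V"
    by (simp add: openin_prod_Times_iff)
  have V: "fst x \<in> {0..1}" "snd x \<in> M" "snd x \<notin> X" if "x \<in> topspace ?S" for x
    using that gap_X[of "snd x"] by auto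
  have y: "continuous_map ?S mtopology snd"
    by (intro continuous_map_from_subtopology continuous_map_snd)
  have "continuous_map ?Z euclideanreal fst"
    using continuous_map_from_unit_interval[OF continuous_map_fst] by blast
  then have s: "continuous_map ?S euclideanreal fst"
    by (rule continuous_map_from_subtopology)
  have settle: "settle (fst x) (snd x) = interpolate (fst x) (reach (track (snd x), gap (snd x))) 1"
    if "x \<in> topspace ?S" for x
    using V(3)[OF that] by (simp add: settle_def)
  have "continuous_map ?S unit_interval (\<lambda>x. interpolate (fst x) (reach (track (snd x), gap (snd x))) 1)"
  proof (intro continuous_map_into_unit_interval continuous_map_interpolate s
      continuous_map_reach continuous_map_track continuous_map_gap y)
    fix x assume x: "x \<in> topspace ?S"
    from settle_unit_interval[OF V(1,2)[OF x]]
    show "interpolate (fst x) (reach (track (snd x), gap (snd x))) 1 \<in> {0..1}"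
      unfolding settle[OF x] .
    show "snd x \<notin> X" by (rule V(3)[OF x])
  qed simp
  then have "continuous_map ?S mtopology
      (\<lambda>x. R (snd x, interpolate (fst x) (reach (track (snd x), gap (snd x))) 1))"
    by (rule continuous_map_R[OF y])
  then show "continuous_map ?S mtopology (\<lambda>x. R (snd x, settle (fst x) (snd x)))"
    by (rule continuous_map_eq) (simp only: settle)
  fix x assume "x \<in> topspace ?Z - ?V"
  then have x: "fst x \<in> {0..1}" "snd x \<in> M" "snd x \<in> X"
    using gap_pos[of "snd x"] by (auto simp: mem_Times_iff)
  have Rx: "R (snd x, t) = snd x" if "t \<in> {0..1}" for t
    using R_X[OF x(3) that] .
  then have settled: "R (snd x, settle (fst x) (snd x)) = snd x"
    using settle_unit_interval[OF x(1,2)] by blast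
  then show "R (snd x, settle (fst x) (snd x)) \<in> topspace mtopology"
    using x by simp
  fix U assume U: "openin mtopology U" "R (snd x, settle (fst x) (snd x)) \<in> U"
  let ?C = "compact_open_topology unit_interval mtopology"
  \<comment> \<open>Confining the whole interval to \<open>U\<close> is a compact-open condition, so
    \<open>?W\<close> is an open set of points with all of their track in \<open>U\<close>.\<close>
  let ?G = "{g \<in> extensional (topspace unit_interval).
    continuous_map unit_interval mtopology g \<and> g ` {0..1} \<subseteq> U}"
  let ?W = "{y \<in> topspace mtopology. restrict (\<lambda>t. R (y, t)) {0..1} \<in> ?G}"
  have "continuous_map mtopology ?C (\<lambda>y. restrict (\<lambda>t. R (y, t)) {0..1})"
    by (rule continuous_map_path_curry[OF R_cont])
  moreover have "openin ?C ?G"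
    by (intro openin_compact_open_topology U) simp
  ultimately have W: "openin mtopology ?W"
    using openin_continuous_map_preimage by blast
  have "continuous_map unit_interval mtopology (restrict (\<lambda>t. R (snd x, t)) {0..1})"
    using continuous_R_path[OF x(2)] by (rule continuous_map_eq) simp
  moreover have "restrict (\<lambda>t. R (snd x, t)) {0..1} ` {0..1} \<subseteq> U"
    using Rx U(2) settled by (simp add: image_subset_iff)
  ultimately have "snd x \<in> ?W"
    using x by simp
  then have "x \<in> {0..1} \<times> ?W" using x by (simp add: mem_Times_iff)
  moreover have "openin ?Z ({0..1} \<times> ?W)"
    using W by (simp add: openin_prod_Times_iff)
  moreover have "R (y, settle s y) \<in> U" if "s \<in> {0..1}" "y \<in> ?W" for s y
  proof -
    have "R (y, t) \<in> U" if "t \<in> {0..1}" for t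
      using \<open>y \<in> ?W\<close> that by (simp add: image_subset_iff)
    then show ?thesis using settle_unit_interval that by simp
  qed
  ultimately show "\<exists>W. openin ?Z W \<and> x \<in> W \<and> (\<lambda>x. R (snd x, settle (fst x) (snd x))) ` W \<subseteq> U"
    by (intro exI[of _ "{0..1} \<times> ?W"]) (simp add: image_subset_iff)
qed

text \<open>On the square of points \<open>R (w a, b)\<close> the edges \<open>a = 0\<close> and \<open>b = 0\<close> lie in \<open>X\<close> and the
  rest lies in one stratum. The path \<open>track (w \<phi>)\<close> with \<open>\<phi> = reach (w, t)\<close> is the vertical
  segment over \<open>a = \<phi>\<close>; it is deformed first to the diagonal and then to the top edge \<open>w\<close>,
  with its initial point moving along \<open>b = 0\<close> and then along \<open>a = 0\<close>.\<close>

definition square_path :: "real \<Rightarrow> (real \<Rightarrow> 'a) \<times> real \<Rightarrow> real \<Rightarrow> 'a" where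
  "square_path s = (\<lambda>(w, t) u.
     R (w (interpolate (min 1 (2 * s)) (reach (w, t)) u), interpolate (max 0 (2 * s - 1)) u 1))"

text \<open>The height moves linearly from that of \<open>to_cylinder (slide 1 z)\<close> to the
  original one; the base stays fixed.\<close>

definition cylinder_homotopy ::
    "real \<times> ('a + (real \<Rightarrow> 'a) \<times> real) \<Rightarrow> 'a + (real \<Rightarrow> 'a) \<times> real" where
  "cylinder_homotopy = (\<lambda>(s, z). case_sum Inl (\<lambda>(w, t).
     Inr (restrict (square_path s (w, t)) {0..1}, interpolate s (gap (w (reach (w, t)))) t)) z)"

lemma cylinder_homotopy_simps [simp]:
  "cylinder_homotopy (s, Inl x) = Inl x"
  "cylinder_homotopy (s, Inr (w, t)) =
     Inr (restrict (square_path s (w, t)) {0..1}, interpolate s (gap (w (reach (w, t)))) t)"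
  by (auto simp: cylinder_homotopy_def)

lemma continuous_map_square_path:
  assumes s: "continuous_map Z unit_interval s" and w: "continuous_map Z H w"
    and t: "continuous_map Z euclideanreal t" and u: "continuous_map Z unit_interval u"
    and t01: "\<And>z. z \<in> topspace Z \<Longrightarrow> t z \<in> {0<..1}"
  shows "continuous_map Z mtopology (\<lambda>z. square_path (s z) (w z, t z) (u z))"
  unfolding square_path_def case_prod_conv
proof (intro continuous_map_R continuous_map_H_eval w continuous_map_into_unit_interval
    continuous_map_interpolate continuous_map_real_min continuous_map_real_max
    continuous_map_real_mult continuous_map_diff continuous_map_reach t
    continuous_map_from_unit_interval[OF s] continuous_map_from_unit_interval[OF u])
  fix z assume z: "z \<in> topspace Z"
  have s01: "s z \<in> {0..1}" and u01: "u z \<in> {0..1}" and wz: "w z \<in> topspace H"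
    using s u w z by (auto simp: continuous_map_def)
  show "interpolate (min 1 (2 * s z)) (reach (w z, t z)) (u z) \<in> {0..1}"
    using s01 u01 reach_in[OF wz t01[OF z]] by (intro interpolate_unit_interval) auto
  show "interpolate (max 0 (2 * s z - 1)) (u z) 1 \<in> {0..1}"
    using s01 u01 by (intro interpolate_unit_interval) auto
qed auto

lemma square_path_0:
  assumes "w \<in> topspace H" "t \<in> {0<..1}" "s \<in> {0..1}"
  shows "square_path s (w, t) 0 \<in> X"
proof (cases "s \<le> 1/2")
  \<comment> \<open>In the first half the second argument of \<open>R\<close> is 0; in the second
    half the path parameter is 0 and \<open>R\<close> fixes \<open>w 0\<close>.\<close>
  case True
  then have "square_path s (w, t) 0 = R (w (interpolate (min 1 (2 * s)) (reach (w, t)) 0), 0)"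
    by (simp add: square_path_def)
  moreover have "interpolate (min 1 (2 * s)) (reach (w, t)) 0 \<in> {0..1}"
    using assms reach_in[OF assms(1,2)] by (intro interpolate_unit_interval) auto
  ultimately show ?thesis using H_in_M[OF assms(1)] R_0 by simp
next
  case False
  then have "square_path s (w, t) 0 = R (w 0, 2 * s - 1)"
    by (simp add: square_path_def)
  then show ?thesis using assms False R_X[of "w 0" "2 * s - 1"] by (auto simp: in_H_iff)
qed

text \<open>Both coordinates in the square are positive because \<open>reach (w, t)\<close> and
  \<open>u\<close> are; so \<open>R\<close> is applied at a positive time to a point of the path off
  \<open>X\<close>.\<close>

lemma square_path_pos:
  assumes "w \<in> topspace H" "t \<in> {0<..1}" "s \<in> {0..1}" "u \<in> {0<..1}"
  shows "square_path s (w, t) u \<notin> X"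
    and "i \<le> n \<Longrightarrow> (\<And>u. u \<in> {0<..1} \<Longrightarrow> w u \<in> stratum F i) \<Longrightarrow> square_path s (w, t) u \<in> stratum F i"
proof -
  have "interpolate (min 1 (2 * s)) (reach (w, t)) u \<in> {0<..1}" (is "?a \<in> _")
    using assms reach_in[OF assms(1,2)] by (intro interpolate_pos) auto
  moreover have "interpolate (max 0 (2 * s - 1)) u 1 \<in> {0<..1}" (is "?b \<in> _")
    using assms by (intro interpolate_pos) auto
  moreover have "square_path s (w, t) u = R (w ?a, ?b)" by (simp add: square_path_def)
  ultimately show "square_path s (w, t) u \<notin> X"
    "i \<le> n \<Longrightarrow> (\<And>u. u \<in> {0<..1} \<Longrightarrow> w u \<in> stratum F i) \<Longrightarrow> square_path s (w, t) u \<in> stratum F i"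
    using assms(1) R_notin[of "w ?a" ?b] R_stratum[of i "w ?a" ?b] by (auto simp: in_H_iff)
qed

lemma square_path_in_H:
  assumes "w \<in> topspace H" "t \<in> {0<..1}" "s \<in> {0..1}"
  shows "restrict (square_path s (w, t)) {0..1} \<in> topspace H"
proof -
  obtain i where i: "i \<le> n" "\<And>t. t \<in> {0<..1} \<Longrightarrow> w t \<in> stratum F i"
    using assms by (auto simp: in_H_iff)
  have "continuous_map unit_interval mtopology (\<lambda>u. square_path s (w, t) u)"
    using assms by (intro continuous_map_square_path) auto
  then show ?thesis
    using assms i square_path_0 square_path_pos by (intro restrict_in_H[where i = i]) auto
qed

lemma cylinder_homotopy_height_in:
  assumes "w \<in> topspace H" "t \<in> {0<..1}" "s \<in> {0..1}"
  shows "interpolate s (gap (w (reach (w, t)))) t \<in> {0<..1}"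
proof -
  have "w (reach (w, t)) \<in> M - X"
    using assms(1) reach_in[OF assms(1,2)] by (auto simp: in_H_iff)
  then show ?thesis using assms gap_pos by (intro interpolate_pos) auto
qed

lemma homotopy_on_cylinder:
  "continuous_map (prod_topology unit_interval Cyl) Cyl cylinder_homotopy"
proof (rule continuous_map_into_Cyl)
  let ?Z = "prod_topology unit_interval Cyl"
  show "cylinder_homotopy \<in> topspace ?Z \<rightarrow> topspace Cyl"
    using square_path_in_H cylinder_homotopy_height_in by (auto simp: topspace_Cyl)
  have s: "continuous_map ?Z euclideanreal fst"
    using continuous_map_from_unit_interval[OF continuous_map_fst] by blast
  \<comment> \<open>The initial point of the deformed path, written through \<open>slide\<close> so
    that the same formula is continuous across the base.\<close>
  have "continuous_map ?Z mtopology
      (\<lambda>x. R (slide (1 - min 1 (2 * fst x)) (snd x), max 0 (2 * fst x - 1)))"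
    by (intro continuous_map_R continuous_map_slide continuous_map_snd continuous_map_into_unit_interval
        continuous_map_diff continuous_map_real_min continuous_map_real_max continuous_map_real_mult s)
      auto
  then show "continuous_map ?Z mtopology (\<lambda>x. base (cylinder_homotopy x))"
    by (rule continuous_map_eq) (auto simp: topspace_Cyl R_X square_path_def)
  \<comment> \<open>On the base \<open>slide 1\<close> is the identity and \<open>gap\<close>
    vanishes there, so both ends of the interpolation are 0.\<close>
  have "continuous_map ?Z euclideanreal
      (\<lambda>x. interpolate (fst x) (gap (slide 1 (snd x))) (cylinder_height (snd x)))"
    by (intro continuous_map_interpolate continuous_map_gap continuous_map_slide continuous_map_snd s
       continuous_map_snd'[OF continuous_map_height]) auto
  then show "continuous_map ?Z euclideanreal (\<lambda>x. cylinder_height (cylinder_homotopy x))"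
    by (rule continuous_map_eq) (auto simp: topspace_Cyl gap_X)
  let ?P = "{x. cylinder_height (cylinder_homotopy x) > 0}"
  let ?S = "subtopology ?Z ?P"
  \<comment> \<open>Points of the base keep height 0, so positive height after the homotopy forces
    an \<open>Inr\<close> point before it.\<close>
  have S: "\<exists>s w t. x = (s, Inr (w, t)) \<and> s \<in> {0..1} \<and> w \<in> topspace H \<and> t \<in> {0<..1}"
    if "x \<in> topspace ?S" for x
    using that by (auto simp: topspace_Cyl)
  have "continuous_map ?S (subtopology Cyl {z. cylinder_height z > 0}) snd"
    using S by (auto simp: continuous_map_in_subtopology continuous_map_from_subtopology
        continuous_map_snd topspace_Cyl)
  from continuous_map_compose[OF this continuous_map_Inr_part]
  have w: "continuous_map ?S H (\<lambda>x. fst (projr (snd x)))" by (simp add: o_def)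
  have t: "continuous_map ?S euclideanreal (\<lambda>x. cylinder_height (snd x))"
    by (intro continuous_map_from_subtopology continuous_map_snd' continuous_map_height)
  have s': "continuous_map ?S unit_interval fst"
    by (intro continuous_map_from_subtopology continuous_map_fst)
  have "continuous_map ?S H (\<lambda>x. restrict
      (square_path (fst x) (fst (projr (snd x)), cylinder_height (snd x))) {0..1})"
  proof (rule continuous_map_H_curry)
    show "continuous_map (prod_topology ?S unit_interval) mtopology
     (\<lambda>x. square_path (fst (fst x)) (fst (projr (snd (fst x))), cylinder_height (snd (fst x))) (snd x))"
    proof (intro continuous_map_square_path continuous_map_fst'[OF w] continuous_map_fst'[OF t]
        continuous_map_fst'[OF s'] continuous_map_snd)
      fix x assume "x \<in> topspace (prod_topology ?S unit_interval)"
      then have "fst x \<in> topspace ?S" by auto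
      from S[OF this] show "cylinder_height (snd (fst x)) \<in> {0<..1}" by auto
    qed
    fix x assume "x \<in> topspace ?S"
    from S[OF this] show "restrict
      (square_path (fst x) (fst (projr (snd x)), cylinder_height (snd x))) {0..1} \<in> topspace H"
      using square_path_in_H by auto
  qed
  then show "continuous_map ?S H (\<lambda>x. fst (projr (cylinder_homotopy x)))"
  proof (rule continuous_map_eq)
    fix x assume "x \<in> topspace ?S"
    from S[OF this] show "restrict
      (square_path (fst x) (fst (projr (snd x)), cylinder_height (snd x))) {0..1} =
      fst (projr (cylinder_homotopy x))"
      by auto
  qed
qed

lemma cylinder_homotopy_0:
  assumes "z \<in> topspace Cyl" shows "cylinder_homotopy (0, z) = to_cylinder (slide 1 z)"
proof -
  have "w (reach (w, t)) \<notin> X" if "w \<in> topspace H" "t \<in> {0<..1}" for w t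
    using that reach_in[OF that] by (auto simp: in_H_iff)
  then show ?thesis
    using assms by (auto simp: topspace_Cyl to_cylinder_def track_def square_path_def)
qed

lemma cylinder_homotopy_1:
  assumes "z \<in> topspace Cyl" shows "cylinder_homotopy (1, z) = z"
proof -
  \<comment> \<open>At \<open>s = 1\<close> the path is \<open>R (w u, 1) = w u\<close>;
    extensionality of \<open>w\<close> turns agreement on the interval into equality of
    functions.\<close>
  have "restrict (square_path 1 (w, t)) {0..1} = w" if "w \<in> topspace H" for w t
    using that H_in_M[OF that] by (intro extensionalityI[of _ "{0..1}"])
      (auto simp: in_H_iff square_path_def R_1)
  then show ?thesis using assms by (auto simp: topspace_Cyl)
qed

section \<open>Preservation of strata and the homotopy equivalence\<close>

lemma preserves_strata_cylinder_homotopy: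
  assumes "s \<in> {0..1}"
  shows "preserves_strata n CylF CylF (\<lambda>z. cylinder_homotopy (s, z))"
  unfolding preserves_strata_def
proof (intro allI impI image_subsetI)
  fix i z assume i: "i \<le> n" and z: "z \<in> stratum CylF i"
  show "cylinder_homotopy (s, z) \<in> stratum CylF i"
  proof (cases z)
    case (Inl x)
    then show ?thesis using z by simp
  next
    case (Inr y)
    then obtain w t where y: "z = Inr (w, t)" by (cases y) auto
    then have w: "w \<in> topspace H" "t \<in> {0<..1}" "\<forall>u\<in>{0<..1}. w u \<in> stratum F i"
      using z unfolding y Inr_in_stratum_Cyl[OF i] by blast+
    then have "square_path s (w, t) u \<in> stratum F i" if "u \<in> {0<..1}" for u
      using square_path_pos(2)[of w t s u i] assms i that by auto
    then show ?thesis
      unfolding y cylinder_homotopy_simps Inr_in_stratum_Cyl[OF i]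
      using w assms square_path_in_H cylinder_homotopy_height_in by auto
  qed
qed

lemma stratum_M: "stratum (\<lambda>i. M \<inter> F i) i = M \<inter> stratum F i"
  by (auto simp: stratum_def)

lemma preserves_strata_R:
  assumes "\<And>y. y \<in> M \<Longrightarrow> \<sigma> y \<in> {0<..1}"
  shows "preserves_strata n (\<lambda>i. M \<inter> F i) (\<lambda>i. M \<inter> F i) (\<lambda>y. R (y, \<sigma> y))"
  unfolding preserves_strata_def stratum_M
proof (intro allI impI image_subsetI)
  fix i y assume "i \<le> n" "y \<in> M \<inter> stratum F i"
  then show "R (y, \<sigma> y) \<in> M \<inter> stratum F i"
    using assms[of y] R_stratum[of i y "\<sigma> y"] R_in[of y "\<sigma> y"] by auto
qed

lemma preserves_strata_to_cylinder: "preserves_strata n (\<lambda>i. M \<inter> F i) CylF to_cylinder"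
  unfolding preserves_strata_def stratum_M
proof (intro allI impI image_subsetI)
  fix i y assume i: "i \<le> n" and y: "y \<in> M \<inter> stratum F i"
  show "to_cylinder y \<in> stratum CylF i"
  proof (cases "y \<in> X")
    case True
    then show ?thesis using y by (simp add: to_cylinder_def Inl_in_stratum_Cyl)
  next
    case False
    then have "\<forall>u\<in>{0<..1}. track y u \<in> stratum F i"
      using y i R_stratum by (auto simp: track_def)
    then show ?thesis
      using False y i track_in_H gap_pos by (auto simp: to_cylinder_def Inr_in_stratum_Cyl)
  qed
qed

lemma preserves_strata_slide: "preserves_strata n CylF (\<lambda>i. M \<inter> F i) (slide 1)"
  unfolding preserves_strata_def stratum_M
proof (intro allI impI image_subsetI)
  fix i z assume i: "i \<le> n" and z: "z \<in> stratum CylF i"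
  show "slide 1 z \<in> M \<inter> stratum F i"
  proof (cases z)
    case (Inl x)
    then show ?thesis using z X_subset by (auto simp: Inl_in_stratum_Cyl)
  next
    case (Inr y)
    then obtain w t where y: "z = Inr (w, t)" by (cases y) auto
    then have w: "w \<in> topspace H" "t \<in> {0<..1}" "\<forall>u\<in>{0<..1}. w u \<in> stratum F i"
      using z unfolding y Inr_in_stratum_Cyl[OF i] by blast+
    then show ?thesis
      using y reach_in[OF w(1,2)] H_in_M[OF w(1), of "reach (w, t)"] by auto
  qed
qed

text \<open>Stratum preservation thus depends only on values on the space, which the
  characterization of \<open>homotopic_with\<close> by a homotopy demands.\<close>

lemma stratum_subset_topspace:
  assumes "i \<le> n"
  shows "stratum CylF i \<subseteq> topspace Cyl"
  by (auto simp: stratum_def holink_cylinder_filtration_def topspace_Cyl strat_holink_filtration_def)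

theorem to_cylinder_equivalence:
  "stratum_preserving_homotopy_equivalence n mtopology (\<lambda>i. M \<inter> F i) Cyl CylF to_cylinder"
  unfolding stratum_preserving_homotopy_equivalence_def stratum_preserving_map_def
    stratum_preserving_homotopic_def
proof (intro conjI exI[of _ "slide 1"])
  show "continuous_map Cyl mtopology (slide 1)"
    using continuous_map_slide[of Cyl "\<lambda>_. 1" "\<lambda>z. z"] by simp
  show "homotopic_with (preserves_strata n (\<lambda>i. M \<inter> F i) (\<lambda>i. M \<inter> F i)) mtopology mtopology
      (slide 1 \<circ> to_cylinder) id"
  proof (subst homotopic_with)
    show "\<exists>h. continuous_map (prod_topology unit_interval mtopology) mtopology h \<and>
        (\<forall>x\<in>topspace mtopology. h (0, x) = (slide 1 \<circ> to_cylinder) x) \<and>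
        (\<forall>x\<in>topspace mtopology. h (1, x) = id x) \<and>
        (\<forall>t\<in>{0..1}. preserves_strata n (\<lambda>i. M \<inter> F i) (\<lambda>i. M \<inter> F i) (\<lambda>x. h (t, x)))"
    proof (intro exI[of _ "\<lambda>x. R (snd x, settle (fst x) (snd x))"] conjI ballI homotopy_on_space)
      fix y assume y: "y \<in> topspace mtopology"
      show "R (snd (0, y), settle (fst (0, y)) (snd (0, y))) = (slide 1 \<circ> to_cylinder) y"
      proof (cases "y \<in> X")
        case True
        then show ?thesis by (simp add: to_cylinder_def settle_def R_X)
      next
        case False
        \<comment> \<open>The path \<open>track y\<close> is restricted, so its value at this time
          equals \<open>R\<close> only inside the interval.\<close>
        then have "reach (track y, gap y) \<in> {0..1}"
          using y reach_in[OF track_in_H gap_pos, of y y] by simp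
        with False show ?thesis by (simp add: to_cylinder_def settle_def track_def)
      qed
      show "R (snd (1, y), settle (fst (1, y)) (snd (1, y))) = id y"
        using y by (simp add: settle_def R_1)
    next
      fix t :: real assume t: "t \<in> {0..1}"
      show "preserves_strata n (\<lambda>i. M \<inter> F i) (\<lambda>i. M \<inter> F i)
          (\<lambda>x. R (snd (t, x), settle (fst (t, x)) (snd (t, x))))"
        unfolding fst_conv snd_conv by (rule preserves_strata_R) (rule settle_pos[OF t])
    qed
  qed (auto simp: preserves_strata_def stratum_M)
  show "homotopic_with (preserves_strata n CylF CylF) Cyl Cyl (to_cylinder \<circ> slide 1) id"
  proof (subst homotopic_with)
    show "\<exists>h. continuous_map (prod_topology unit_interval Cyl) Cyl h \<and>
        (\<forall>x\<in>topspace Cyl. h (0, x) = (to_cylinder \<circ> slide 1) x) \<and>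
        (\<forall>x\<in>topspace Cyl. h (1, x) = id x) \<and>
        (\<forall>t\<in>{0..1}. preserves_strata n CylF CylF (\<lambda>x. h (t, x)))"
      by (intro exI[of _ cylinder_homotopy] conjI ballI homotopy_on_cylinder
          preserves_strata_cylinder_homotopy)
        (simp_all add: cylinder_homotopy_0 cylinder_homotopy_1)
  next
    fix h k :: "'a + (real \<Rightarrow> 'a) \<times> real \<Rightarrow> 'a + (real \<Rightarrow> 'a) \<times> real"
    assume "\<And>x. x \<in> topspace Cyl \<Longrightarrow> h x = k x"
    then have "h ` stratum CylF i = k ` stratum CylF i" if "i \<le> n" for i
      using stratum_subset_topspace[OF that] by (intro image_cong) auto
    then show "preserves_strata n CylF CylF h = preserves_strata n CylF CylF k"
      by (auto simp: preserves_strata_def)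
  qed
qed (rule continuous_map_to_cylinder preserves_strata_to_cylinder preserves_strata_slide)+

end

section \<open>Filtered spaces and passage to a metric on the neighborhood\<close>

lemma filtered_space_mono:
  assumes "filtered_space Y n F" "i \<le> j" "j \<le> n"
  shows "F i \<subseteq> F j"
  using assms(2,3)
proof (induction j rule: dec_induct)
  case (step k)
  then have "F i \<subseteq> F k" by simp
  also have "F k \<subseteq> F (Suc k)" using assms(1) step by (simp add: filtered_space_def)
  finally show ?case .
qed simp

lemma filtered_space_strata_cover:
  assumes "filtered_space Y n F"
  shows "topspace Y \<subseteq> (\<Union>i\<le>n. stratum F i)"
proof
  fix y assume "y \<in> topspace Y"
  then have y: "y \<in> F n" using assms by (simp add: filtered_space_def)
  \<comment> \<open>The index of the stratum through \<open>y\<close> is the least one; for index 0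
    nothing is subtracted in \<open>stratum\<close>.\<close>
  define i where "i = (LEAST i. y \<in> F i)"
  have "y \<in> F i" unfolding i_def using y by (rule LeastI)
  moreover have "i \<le> n" unfolding i_def using y by (rule Least_le)
  moreover have "y \<notin> F (i - 1)" if "i \<noteq> 0"
    using that not_less_Least[of "i - 1" "\<lambda>i. y \<in> F i", folded i_def] by simp
  ultimately have "y \<in> stratum F i" by (simp add: stratum_def)
  with \<open>i \<le> n\<close> show "y \<in> (\<Union>i\<le>n. stratum F i)" by blast
qed

theorem propositionA1:
  fixes Y :: "'a topology" and n :: nat and F :: "nat \<Rightarrow> 'a set"
    and X N :: "'a set" and R :: "'a \<times> real \<Rightarrow> 'a"
  assumes "metrizable_space Y"
    and "manifold_weakly_stratified Y n F"
    and "pure_subset Y n F X"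
    and "neighborhood_in Y X N"
    and "nearly_sp_deformation_retraction n F (subtopology Y N) X R"
  shows "\<exists>f. stratum_preserving_homotopy_equivalence n
               (subtopology Y N) (\<lambda>i. N \<inter> F i)
               (holink_cylinder n F (subtopology Y N) X)
               (holink_cylinder_filtration n F (subtopology Y N) X) f"
proof -
  have fs: "filtered_space Y n F"
    using assms(2) by (simp add: manifold_weakly_stratified_def weakly_stratified_def)
  have N: "N \<subseteq> topspace Y" "X \<subseteq> N"
    using assms(4) interior_of_subset[of Y N] by (auto simp: neighborhood_in_def)
  have "metrizable_space (subtopology Y N)"
    using assms(1) by (rule metrizable_space_subtopology)
  then obtain M d where Md: "Metric_space M d" "subtopology Y N = Metric_space.mtopology M d"
    unfolding metrizable_space_def by blast
  \<comment> \<open>Metrizability supplies its own carrier; comparing underlying sets identifies it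
    with \<open>N\<close>.\<close>
  have "M = topspace (subtopology Y N)"
    unfolding Md(2) by (rule Metric_space.topspace_mtopology[OF Md(1), symmetric])
  also have "\<dots> = N" using N(1) by (simp add: Int_absorb1)
  finally have N_metric: "Metric_space N d" "subtopology Y N = Metric_space.mtopology N d"
    using Md by simp_all
  interpret nsp_retraction N d n F X R
  proof (intro nsp_retraction.intro nsp_retraction_axioms.intro)
    show "nearly_sp_deformation_retraction n F (Metric_space.mtopology N d) X R"
      using assms(5) N_metric(2) by simp
    show "N \<subseteq> (\<Union>i\<le>n. stratum F i)"
      using filtered_space_strata_cover[OF fs] N by blast
    show "F i \<subseteq> F j" if "i \<le> j" "j \<le> n" for i j
      using fs that by (rule filtered_space_mono)
  qed (rule N_metric N)+
  show ?thesis
    unfolding N_metric(2) using to_cylinder_equivalence by blast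
qed

end
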